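(* Suppose that every simple polygon in the plane has a visibility-preserving convexification. Then every simple polygon in the plane has a visibility-preserving convexification that uses only single-vertex moves, i.e. for every simple polygon $P$ there is a finite (possibly empty) sequence of visibility-preserving single-vertex moves, the first with initial polygon $P$ and each subsequent one having as initial polygon the final polygon of the preceding one, such that the final polygon obtained at the end of the sequence is convex.
   Context: Polygons. A polygon consists of a finite set $\{p_1,\dots,p_n\}$ of points in the plane (the vertices, $n\ge 3$), together with the straight segments (the edges) joining $p_i$ to $p_{i+1}$ for $i=1,\dots,n$ (indices modulo $n$). All polygons are assumed simple: edges intersect only in a common endpoint. The interior of $P$ is the bounded region it encloses, and $P$ is convex in the usual sense (the closed region it bounds is a convex set). Let $\mathscr{P}_n$ be the collection of all (simple) polygons on $n$ vertices. Visibility. Two points in $P$ are (internally) visible in $P$, or $P$-visible, if the open segment joining them is contained in the interior of $P$. In particular, adjacent vertices are not visible to each other. Metric. For $P,Q\in\mathscr{P}_n$ with vertices $p_1,\dots,p_n$ and $q_1,\dots,q_n$, the distance is $d(P,Q)=\min_\sigma \max_{i}\|p_i-q_{\sigma(i)}\|$, where $\|\cdot\|$ is the Euclidean norm and $\sigma$ ranges over all bijections of $\{1,\dots,n\}$. Transformations. A transformation $P^{[a,d]}$ of a polygon $P\in\mathscr{P}_n$ with vertices $p_1,\dots,p_n$ is given by a closed time interval $[a,d]$ and, for each vertex $p_i$, a continuous map $t\mapsto p_i^t$ (the orbit of $p_i$) from $[a,d]$ to the plane with $p_i^a=p_i$, such that for each $t\in[a,d]$ the points $p_1^t,\dots,p_n^t$,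 with edges joining $p_i^t$ to $p_{i+1}^t$, form a (simple) polygon $P^t\in\mathscr{P}_n$. Thus $t\mapsto P^t$ is a continuous map from $[a,d]$ to $\mathscr{P}_n$; $P^a=P$ is the initial polygon and $P^d$ the final polygon. The transformation is a convexification of $P$ if $P^d$ is convex. It is a single-vertex move if only one of the orbits is not a constant map. It is visibility-preserving if for all $i,j\in\{1,\dots,n\}$ and all $a\le s\le t\le d$: if $p_i^s$ and $p_j^s$ are $P^s$-visible, then $p_i^t$ and $p_j^t$ are $P^t$-visible. A convexification uses only single-vertex moves if at most one vertex is moved at a time, i.e. it is the concatenation of a finite sequence of single-vertex moves. *)

theory Defs
  imports "HOL-Analysis.Analysis"
begin

text \<open>
  The plane is the type of complex numbers, whose norm is the Euclidean norm. A polygon on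
  \<open>n\<close> vertices is given by the list of its vertices in cyclic order; its edges join
  \<open>P ! i\<close> to \<open>P ! (i + 1)\<close>, indices modulo \<open>n\<close>. A transformation keeps track of the vertex
  labels, so the starting point and the orientation of this list play no role.
\<close>

definition next_vertex :: "complex list \<Rightarrow> nat \<Rightarrow> complex" where
  "next_vertex P i = P ! (Suc i mod length P)"

definition edge :: "complex list \<Rightarrow> nat \<Rightarrow> complex set" where
  "edge P i = closed_segment (P ! i) (next_vertex P i)"

text \<open>
  Collinear consecutive vertices are allowed as long as the two edges meet only in their
  common endpoint.
\<close>

definition simple_polygon :: "complex list \<Rightarrow> bool" where
  "simple_polygon P \<longleftrightarrow>
     length P \<ge> 3 \<and> distinct P \<and>
     (\<forall>i<length P. \<forall>j<length P. i \<noteq> j \<longrightarrow>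
        edge P i \<inter> edge P j \<subseteq> {P ! i, next_vertex P i} \<inter> {P ! j, next_vertex P j})"

definition polygon_boundary :: "complex list \<Rightarrow> complex set" where
  "polygon_boundary P = (\<Union>i<length P. edge P i)"

definition polygon_interior :: "complex list \<Rightarrow> complex set" where
  "polygon_interior P = inside (polygon_boundary P)"

definition polygon_region :: "complex list \<Rightarrow> complex set" where
  "polygon_region P = polygon_boundary P \<union> polygon_interior P"

definition convex_polygon :: "complex list \<Rightarrow> bool" where
  "convex_polygon P \<longleftrightarrow> simple_polygon P \<and> convex (polygon_region P)"

text \<open>
  The condition \<open>x \<noteq> y\<close> is needed because the library's open segment from a point to itself
  is empty.
\<close>

definition visible :: "complex list \<Rightarrow> complex \<Rightarrow> complex \<Rightarrow> bool" where
  "visible P x y \<longleftrightarrow>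
     x \<in> polygon_region P \<and> y \<in> polygon_region P \<and> x \<noteq> y \<and>
     open_segment x y \<subseteq> polygon_interior P"

text \<open>
  A transformation of \<open>P\<close> over the time interval \<open>{a..d}\<close> is a function \<open>T\<close> sending a time to
  a polygon; the orbit of the \<open>i\<close>-th vertex is \<open>\<lambda>t. T t ! i\<close>. Values of \<open>T\<close> outside
  \<open>{a..d}\<close> are irrelevant.
\<close>

definition transformation ::
    "complex list \<Rightarrow> real \<Rightarrow> real \<Rightarrow> (real \<Rightarrow> complex list) \<Rightarrow> bool" where
  "transformation P a d T \<longleftrightarrow>
     a \<le> d \<and> T a = P \<and>
     (\<forall>t\<in>{a..d}. length (T t) = length P \<and> simple_polygon (T t)) \<and>
     (\<forall>i<length P. continuous_on {a..d} (\<lambda>t. T t ! i))"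

definition convexification ::
    "complex list \<Rightarrow> real \<Rightarrow> real \<Rightarrow> (real \<Rightarrow> complex list) \<Rightarrow> bool" where
  "convexification P a d T \<longleftrightarrow> transformation P a d T \<and> convex_polygon (T d)"

definition single_vertex_move ::
    "complex list \<Rightarrow> real \<Rightarrow> real \<Rightarrow> (real \<Rightarrow> complex list) \<Rightarrow> bool" where
  "single_vertex_move P a d T \<longleftrightarrow>
     transformation P a d T \<and>
     (\<exists>!i. i < length P \<and> \<not> (\<lambda>t. T t ! i) constant_on {a..d})"

definition visibility_preserving ::
    "complex list \<Rightarrow> real \<Rightarrow> real \<Rightarrow> (real \<Rightarrow> complex list) \<Rightarrow> bool" where
  "visibility_preserving P a d T \<longleftrightarrow>
     (\<forall>i<length P. \<forall>j<length P. \<forall>s t. a \<le> s \<and> s \<le> t \<and> t \<le> d \<longrightarrow>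
        visible (T s) (T s ! i) (T s ! j) \<longrightarrow> visible (T t) (T t ! i) (T t ! j))"

end

theory Submission
  imports Defs "HOL-Complex_Analysis.Winding_Numbers"
begin

text \<open>
  The set of polygons near a simple polygon \<open>P\<close> on the same number of vertices consists of simple
  polygons in which every pair of vertices visible in \<open>P\<close> is still visible. By compactness, the
  given convexification of \<open>P\<close> can therefore be shadowed by straight moves of one vertex at a time,
  along which no visibility of \<open>P\<close> is lost. Such moves may gain a visibility and lose it again.
  But along a straight move the visibilities right after a given time are constant, since they are
  governed by signs of polynomials in the time; so the motion can be stopped just after the first
  gain, where nothing has been lost yet, and one starts afresh from the polygon reached. As there
  are at most \<open>n\<^sup>2\<close> visible pairs, this happens finitely often.
\<close>

text \<open>The interior is given as \<open>inside\<close> of the boundary, which does not show how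
  it varies with the vertices. Winding numbers supply this: for a simple polygon they detect the
  interior, and nearby loops have equal winding numbers. Visibility of two vertices then splits into
  a condition on segments (the open chord misses every edge) and a single interior test at the
  midpoint of the chord.

  Openness of the first condition is not plain compactness, because adjacent edges, or a chord and
  an edge at one of its ends, touch already in the limit. There the directions of the two segments
  at the common end decide.

  Stopping at the infimum \<open>s\<close> of the times of gain is useless: visibility is open, so
  at \<open>s\<close> itself nothing has been gained yet. One must stop strictly later, and a motion
  whose visibilities oscillate just after \<open>s\<close> would allow no such time. This is why the
  given transformation is first replaced by straight moves, whose coordinates are polynomial in the
  time.\<close>

section \<open>The boundary as a closed path and the stability of the interior\<close>

text \<open>
  The hat functions on a cycle of length \<open>n\<close>, unrolled to \<open>{0..n}\<close>: vertex \<open>0\<close> has half a hat at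
  either end. Writing the boundary path as a linear combination of the vertices makes its
  continuity in the parameter and its dependence on the vertices evident.
\<close>

definition hat :: "nat \<Rightarrow> nat \<Rightarrow> real \<Rightarrow> real" where
  "hat n i s = (if i = 0 then max 0 (1 - \<bar>s\<bar>) + max 0 (1 - \<bar>s - n\<bar>) else max 0 (1 - \<bar>s - i\<bar>))"

definition boundary_path :: "complex list \<Rightarrow> real \<Rightarrow> complex" where
  "boundary_path P t = (\<Sum>i<length P. of_real (hat (length P) i (t * length P)) * P ! i)"

lemma continuous_on_hat [continuous_intros]:
  "continuous_on A f \<Longrightarrow> continuous_on A (\<lambda>x. hat n i (f x))"
  unfolding hat_def by (cases "i = 0") (auto intro!: continuous_intros)

lemma hat_bounds: "0 \<le> hat n i s" "hat n i s \<le> 2"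
  by (auto simp: hat_def)

text \<open>Only the hats at the two ends of edge \<open>k\<close> survive. If
  \<open>Suc k = n\<close>, the far end is vertex \<open>0\<close>, whose second bump is centred at
  \<open>n\<close>.\<close>

lemma hat_on_edge:
  assumes "2 \<le> n" "i < n" "k < n" "0 \<le> u" "u \<le> 1"
  shows "hat n i (real k + u) = (if i = k then 1 - u else 0) + (if i = Suc k mod n then u else 0)"
proof (cases "Suc k = n")
  case True
  then have "Suc k mod n = 0" "k \<noteq> 0" "real n = real k + 1" using assms by auto
  moreover have "i = 0 \<or> i = k \<or> (0 < i \<and> i < k)" using True assms by linarith
  moreover have "i < k \<Longrightarrow> real i \<le> real k - 1" by linarith
  ultimately show ?thesis using assms by (auto simp: hat_def)
next
  case False
  then have "Suc k < n" using assms by simp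
  then have [simp]: "Suc k mod n = Suc k" and n: "real n \<ge> real k + 2" by simp_all
  consider "i < k" | "i = k" | "i = Suc k" | "i > Suc k" by linarith
  then show ?thesis
  proof cases
    case 1
    then have "real i \<le> real k - 1" by linarith
    with 1 n assms show ?thesis by (auto simp: hat_def)
  next
    case 4
    then have "real i \<ge> real k + 2" by linarith
    with 4 n assms show ?thesis by (auto simp: hat_def)
  qed (use n assms in \<open>auto simp: hat_def\<close>)
qed

lemma boundary_path_on_edge:
  assumes "2 \<le> length P" "k < length P" "0 \<le> u" "u \<le> 1"
  shows "boundary_path P ((real k + u) / length P)
    = of_real (1 - u) * P ! k + of_real u * next_vertex P k"
proof -
  let ?n = "length P"
  have k': "Suc k mod ?n < ?n" using assms by (intro mod_less_divisor) linarith
  have "boundary_path P ((real k + u) / ?n)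
      = (\<Sum>i<?n. (if i = k then of_real (1 - u) * P ! i else 0)
                + (if i = Suc k mod ?n then of_real u * P ! i else 0))"
    unfolding boundary_path_def
  proof (intro sum.cong refl, goal_cases)
    case (1 i)
    have "(real k + u) / ?n * ?n = real k + u" using assms by auto
    then show ?case using hat_on_edge[of ?n i k u] assms 1 by (auto simp: algebra_simps)
  qed
  also have "\<dots> = of_real (1 - u) * P ! k + of_real u * next_vertex P k"
    using assms k' by (simp add: sum.distrib sum.delta next_vertex_def)
  finally show ?thesis .
qed

text \<open>By the last clause, only \<open>t = 1\<close> is represented as the far end of an edge.
  Injectivity of the boundary path rests on this.\<close>

lemma unit_interval_edge_parameter:
  fixes t :: real
  assumes "0 < n" "t \<in> {0..1}"
  obtains k u where "k < n" "0 \<le> u" "u \<le> 1" "t = (real k + u) / n" "t \<noteq> 1 \<Longrightarrow> u < 1"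
proof (cases "t = 1")
  case True
  with assms show ?thesis by (intro that[of "n - 1" 1]) auto
next
  case False
  have nn: "0 \<le> t * n" "t * n < n" using assms False by auto
  have fl: "\<lfloor>t * n\<rfloor> < int n" using nn by linarith
  show ?thesis
  proof (rule that[of "nat \<lfloor>t * n\<rfloor>" "frac (t * n)"])
    show "nat \<lfloor>t * n\<rfloor> < n" using fl nn by linarith
    have "real (nat \<lfloor>t * n\<rfloor>) + frac (t * n) = t * n" using nn by (simp add: frac_def)
    then show "t = (real (nat \<lfloor>t * n\<rfloor>) + frac (t * n)) / n" using assms by simp
  qed (use frac_ge_0 frac_lt_1 less_imp_le in auto)
qed

lemma path_boundary_path [simp]: "path (boundary_path P)"
  unfolding path_def boundary_path_def by (intro continuous_intros)

lemma boundary_path_closed: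
  assumes "2 \<le> length P"
  shows "pathfinish (boundary_path P) = pathstart (boundary_path P)"
proof -
  have "(real (length P - 1) + 1) / length P = 1" "Suc (length P - 1) = length P" using assms by auto
  then show ?thesis
    using boundary_path_on_edge[of P 0 0] boundary_path_on_edge[of P "length P - 1" 1] assms
    by (cases "P = []") (auto simp: pathfinish_def pathstart_def next_vertex_def simp del: One_nat_def)
qed

lemma path_image_boundary_path:
  assumes "2 \<le> length P"
  shows "path_image (boundary_path P) = polygon_boundary P"
proof
  show "path_image (boundary_path P) \<subseteq> polygon_boundary P"
  proof
    fix z assume "z \<in> path_image (boundary_path P)"
    then obtain t where t: "t \<in> {0..1}" "z = boundary_path P t" by (auto simp: path_image_def)
    obtain k u where "k < length P" "0 \<le> u" "u \<le> 1" "t = (real k + u) / length P"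
      using unit_interval_edge_parameter[OF _ t(1), of "length P"] assms
      by (metis less_le_trans zero_less_numeral)
    then show "z \<in> polygon_boundary P"
      using t boundary_path_on_edge[of P k u] assms
      by (auto simp: polygon_boundary_def edge_def in_segment scaleR_conv_of_real)
  qed
next
  show "polygon_boundary P \<subseteq> path_image (boundary_path P)"
  proof
    fix z assume "z \<in> polygon_boundary P"
    then obtain k u where k: "k < length P" "0 \<le> u" "u \<le> 1"
      "z = of_real (1 - u) * P ! k + of_real u * next_vertex P k"
      by (auto simp: polygon_boundary_def edge_def in_segment scaleR_conv_of_real)
    have "(real k + u) / length P \<in> {0..1}" using k by (auto simp: divide_simps)
    then show "z \<in> path_image (boundary_path P)"
      using boundary_path_on_edge[of P k u] k assms unfolding path_image_def by (metis image_eqI)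
  qed
qed

section \<open>The boundary of a simple polygon as a simple loop\<close>

lemma next_vertex_neq:
  assumes "simple_polygon P" "k < length P"
  shows "P ! k \<noteq> next_vertex P k"
proof -
  have "Suc k mod length P \<noteq> k" "Suc k mod length P < length P"
    using assms by (cases "Suc k = length P"; force simp: simple_polygon_def)+
  then show ?thesis
    using assms nth_eq_iff_index_eq[of P k "Suc k mod length P"]
    unfolding simple_polygon_def next_vertex_def by auto
qed

text \<open>On the half-open interval every parameter has \<open>u < 1\<close>, so a point common to
  two different edges can only be the starting vertex of both, contradicting distinctness. The
  parameter \<open>1\<close> is then reduced to \<open>0\<close> because the path is closed.\<close>

lemma simple_path_boundary_path:
  assumes P: "simple_polygon P"
  shows "simple_path (boundary_path P)"
  unfolding simple_path_def loop_free_def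
proof (intro conjI ballI impI)
  let ?n = "length P"
  have n: "3 \<le> ?n" and dist: "distinct P" using P by (auto simp: simple_polygon_def)
  have inj: "x = y" if xy: "x \<in> {0..<1}" "y \<in> {0..<1}" "boundary_path P x = boundary_path P y" for x y
  proof -
    obtain k u where k: "k < ?n" "0 \<le> u" "u < 1" "x = (real k + u) / ?n"
      using unit_interval_edge_parameter[of ?n x] xy n
      by (metis atLeastLessThan_iff atLeastAtMost_iff less_imp_le less_irrefl less_le_trans zero_less_numeral)
    obtain l v where l: "l < ?n" "0 \<le> v" "v < 1" "y = (real l + v) / ?n"
      using unit_interval_edge_parameter[of ?n y] xy n
      by (metis atLeastLessThan_iff atLeastAtMost_iff less_imp_le less_irrefl less_le_trans zero_less_numeral)
    have zk: "boundary_path P x = of_real (1 - u) * P ! k + of_real u * next_vertex P k"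
      using boundary_path_on_edge[of P k u] k n by simp
    have zl: "boundary_path P x = of_real (1 - v) * P ! l + of_real v * next_vertex P l"
      using boundary_path_on_edge[of P l v] l n xy(3) by simp
    show ?thesis
    proof (cases "k = l")
      case True
      have "(of_real u - of_real v) * (next_vertex P k - P ! k) = 0"
        using zk zl True by (simp add: algebra_simps)
      then show ?thesis using next_vertex_neq[OF P \<open>l < ?n\<close>] k l True by simp
    next
      case False
      have "boundary_path P x \<in> edge P k" "boundary_path P x \<in> edge P l"
        using zk zl k l unfolding edge_def in_segment scaleR_conv_of_real
        by (metis less_imp_le of_real_diff of_real_1)+
      then have z: "boundary_path P x \<in> {P ! k, next_vertex P k}" "boundary_path P x \<in> {P ! l, next_vertex P l}"
        using P False k l unfolding simple_polygon_def by blast+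
      have "boundary_path P x \<noteq> next_vertex P k"
      proof
        assume "boundary_path P x = next_vertex P k"
        then have "(1 - of_real u) * (P ! k - next_vertex P k) = 0" using zk by (simp add: algebra_simps)
        then show False using next_vertex_neq[OF P] k by (auto simp: of_real_eq_1_iff)
      qed
      moreover have "boundary_path P x \<noteq> next_vertex P l"
      proof
        assume "boundary_path P x = next_vertex P l"
        then have "(1 - of_real v) * (P ! l - next_vertex P l) = 0" using zl by (simp add: algebra_simps)
        then show False using next_vertex_neq[OF P] l by (auto simp: of_real_eq_1_iff)
      qed
      ultimately have "P ! k = P ! l" using z by auto
      then show ?thesis using dist False k l by (simp add: nth_eq_iff_index_eq)
    qed
  qed
  fix x y assume xy: "x \<in> {0..1::real}" "y \<in> {0..1::real}" "boundary_path P x = boundary_path P y"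
  have e: "boundary_path P 1 = boundary_path P 0"
    using boundary_path_closed[of P] n by (simp add: pathfinish_def pathstart_def)
  show "x = y \<or> x = 0 \<and> y = 1 \<or> x = 1 \<and> y = 0"
  proof (cases "x = 1 \<or> y = 1")
    case True
    then consider "x = 1" "y = 1" | "x = 1" "y \<in> {0..<1}" | "y = 1" "x \<in> {0..<1}"
      using xy by fastforce
    then show ?thesis
    proof cases
      case 2
      have "0 = y" by (rule inj) (use 2 xy(3) e in auto)
      with 2 show ?thesis by blast
    next
      case 3
      have "x = 0" by (rule inj) (use 3 xy(3) e in auto)
      with 3 show ?thesis by blast
    qed blast
  next
    case False
    then have "x = y" using inj[of x y] xy by simp
    then show ?thesis ..
  qed
qed simp

text \<open>A simple loop winds once, in one of the two directions, round each inside point, and a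
  loop has winding number zero about each outside point.\<close>

lemma polygon_interior_iff_winding:
  assumes "simple_polygon P" "z \<notin> polygon_boundary P"
  shows "z \<in> polygon_interior P \<longleftrightarrow> winding_number (boundary_path P) z \<noteq> 0"
proof -
  have n: "2 \<le> length P" using assms by (simp add: simple_polygon_def)
  show ?thesis
  proof
    assume "z \<in> polygon_interior P"
    then have z: "z \<in> inside (path_image (boundary_path P))"
      by (simp add: polygon_interior_def path_image_boundary_path[OF n])
    show "winding_number (boundary_path P) z \<noteq> 0"
    proof (rule simple_closed_path_winding_number_inside[OF simple_path_boundary_path[OF assms(1)]])
    qed (use z in force)+
  next
    assume "winding_number (boundary_path P) z \<noteq> 0"
    then have "z \<notin> outside (polygon_boundary P)"
      using winding_number_zero_in_outside[of "boundary_path P" z] boundary_path_closed[OF n]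
      by (auto simp: path_image_boundary_path[OF n])
    then show "z \<in> polygon_interior P"
      using assms inside_Un_outside[of "polygon_boundary P"] unfolding polygon_interior_def by blast
  qed
qed

text \<open>The factor 2 is the bound for a hat, since the one at vertex \<open>0\<close> is a sum
  of two bumps.\<close>

lemma norm_boundary_path_diff:
  assumes "length Q = length P"
  shows "norm (boundary_path Q t - boundary_path P t) \<le> 2 * (\<Sum>i<length P. norm (Q ! i - P ! i))"
proof -
  have "boundary_path Q t - boundary_path P t
      = (\<Sum>i<length P. of_real (hat (length P) i (t * length P)) * (Q ! i - P ! i))"
    using assms by (simp add: boundary_path_def sum_subtractf algebra_simps)
  also have "norm \<dots> \<le> (\<Sum>i<length P. 2 * norm (Q ! i - P ! i))"
    by (intro sum_norm_le) (auto simp: norm_mult hat_bounds intro!: mult_right_mono)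
  finally show ?thesis by (simp add: sum_distrib_left)
qed

lemma compact_polygon_boundary: "compact (polygon_boundary P)"
  by (simp add: polygon_boundary_def edge_def compact_UN)

text \<open>Subtracting the test point from the loop turns a moving point into the fixed point
  \<open>0\<close>. Once loop and point have together moved by less than the distance
  \<open>e\<close> from \<open>z\<close> to the boundary, the translated loops have the same winding
  number about \<open>0\<close>.\<close>

lemma eventually_polygon_interior:
  assumes P: "simple_polygon P" and z: "z \<notin> polygon_boundary P"
    and Q: "\<forall>\<^sub>F x in F. length (Q x) = length P \<and> simple_polygon (Q x)"
      "\<And>i. i < length P \<Longrightarrow> ((\<lambda>x. Q x ! i) \<longlongrightarrow> P ! i) F" "(w \<longlongrightarrow> z) F"
  shows "\<forall>\<^sub>F x in F. w x \<in> polygon_interior (Q x) \<longleftrightarrow> z \<in> polygon_interior P"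
proof -
  have n: "2 \<le> length P" using P by (simp add: simple_polygon_def)
  have "polygon_boundary P \<noteq> {}" using n unfolding polygon_boundary_def edge_def by fastforce
  define e where "e = setdist {z} (polygon_boundary P)"
  have "e > 0" 
    using z compact_imp_closed[OF compact_polygon_boundary] \<open>polygon_boundary P \<noteq> {}\<close>
    unfolding e_def by (simp add: setdist_gt_0_compact_closed compact_polygon_boundary)
  have e: "e \<le> norm (boundary_path P t - z)" if "t \<in> {0..1}" for t
  proof -
    have "boundary_path P t \<in> polygon_boundary P"
      using that path_image_boundary_path[OF n] by (auto simp: path_image_def)
    then show ?thesis
      using setdist_le_dist[of z "{z}" "boundary_path P t" "polygon_boundary P"]
      by (simp add: e_def dist_norm norm_minus_commute)
  qed
  have "((\<lambda>x. 2 * (\<Sum>i<length P. norm (Q x ! i - P ! i)) + norm (w x - z)) \<longlongrightarrow>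
      2 * (\<Sum>i<length P. norm (P ! i - P ! i)) + norm (z - z)) F"
    by (intro tendsto_intros Q) auto
  then have "\<forall>\<^sub>F x in F. 2 * (\<Sum>i<length P. norm (Q x ! i - P ! i)) + norm (w x - z) < e"
    using \<open>e > 0\<close> by (auto dest!: order_tendstoD(2)[where a = e])
  with Q(1) show ?thesis
  proof eventually_elim
    case (elim x)
    have d: "norm ((boundary_path (Q x) t - w x) - (boundary_path P t - z)) < e" for t
    proof -
      have "norm ((boundary_path (Q x) t - w x) - (boundary_path P t - z))
          \<le> norm (boundary_path (Q x) t - boundary_path P t) + norm (w x - z)"
        using norm_triangle_ineq4[of "boundary_path (Q x) t - boundary_path P t" "w x - z"]
        by (simp add: algebra_simps)
      then show ?thesis using norm_boundary_path_diff[of "Q x" P t] elim by linarith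
    qed
    have "winding_number (\<lambda>t. boundary_path (Q x) t - w x) 0 = winding_number (\<lambda>t. boundary_path P t - z) 0"
    proof (rule winding_number_nearby_loops_eq)
      show "path (\<lambda>t. boundary_path P t - z)" "path (\<lambda>t. boundary_path (Q x) t - w x)"
        using path_boundary_path unfolding path_def by (auto intro!: continuous_intros)
    next
      fix t :: real assume "t \<in> {0..1}"
      then show "norm ((boundary_path (Q x) t - w x) - (boundary_path P t - z))
          < norm ((boundary_path P t - z) - 0)"
        using d[of t] e[of t] by simp
    qed (use boundary_path_closed[of P] boundary_path_closed[of "Q x"] n elim in
          \<open>auto simp: pathfinish_def pathstart_def\<close>)
    \<comment> \<open>The same estimate keeps the moved point off the moved boundary, as the winding
      criterion for \<open>Q x\<close> requires.\<close>
    moreover have "w x \<notin> polygon_boundary (Q x)"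
    proof
      assume "w x \<in> polygon_boundary (Q x)"
      then have "w x \<in> path_image (boundary_path (Q x))"
        using path_image_boundary_path[of "Q x"] n elim by simp
      then obtain t where t: "t \<in> {0..1}" "w x = boundary_path (Q x) t"
        by (auto simp: path_image_def)
      then show False using d[of t] e[OF t(1)] by (simp add: norm_minus_commute)
    qed
    ultimately show ?case
      using polygon_interior_iff_winding[OF P z] polygon_interior_iff_winding[of "Q x" "w x"] elim
        winding_number_offset[of "boundary_path P" z]
        winding_number_offset[of "boundary_path (Q x)" "w x"] by simp
  qed
qed

section \<open>Simplicity and visibility are open conditions\<close>

text \<open>The product has the inner product of the two directions as real part and, up to sign,
  their cross product as imaginary part; it is a nonnegative real iff the directions agree, and then
  the end of the shorter segment lies on the longer one. The nonnegative reals being closed, the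
  right-hand side is an open condition.\<close>

lemma segments_common_end_iff:
  fixes a b c :: complex
  assumes "a \<noteq> b" "a \<noteq> c"
  shows "closed_segment a b \<inter> closed_segment a c \<subseteq> {a} \<longleftrightarrow> (b - a) * cnj (c - a) \<notin> \<real>\<^sub>\<ge>\<^sub>0"
proof
  assume L: "closed_segment a b \<inter> closed_segment a c \<subseteq> {a}"
  show "(b - a) * cnj (c - a) \<notin> \<real>\<^sub>\<ge>\<^sub>0"
  proof
    assume "(b - a) * cnj (c - a) \<in> \<real>\<^sub>\<ge>\<^sub>0"
    then obtain r where r: "r \<ge> 0" "(b - a) * cnj (c - a) = of_real r" by (auto elim: nonneg_Reals_cases)
    define m where "m = r / (cmod (c - a))\<^sup>2"
    have "(b - a) * of_real ((cmod (c - a))\<^sup>2) = of_real r * (c - a)"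
      using r(2) complex_norm_square[of "c - a"] by (metis mult.assoc mult.commute)
    then have m: "b - a = of_real m * (c - a)" using assms by (simp add: m_def field_simps)
    have "m \<ge> 0" "m \<noteq> 0" using r m assms by (auto simp: m_def)
    show False
    proof (cases "m \<le> 1")
      case True
      have "b = (1 - m) *\<^sub>R a + m *\<^sub>R c" using m by (simp add: scaleR_conv_of_real algebra_simps)
      then have "b \<in> closed_segment a c" using True \<open>m \<ge> 0\<close> unfolding in_segment by blast
      then show False using L assms by auto
    next
      case False
      have "c - a = of_real (1 / m) * (b - a)" using m \<open>m \<noteq> 0\<close> by simp
      then have "c = (1 - 1 / m) *\<^sub>R a + (1 / m) *\<^sub>R b"
        by (simp add: scaleR_conv_of_real algebra_simps diff_divide_distrib)
      moreover have "0 \<le> 1 / m" "1 / m \<le> 1" using False by auto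
      ultimately have "c \<in> closed_segment a b" unfolding in_segment by blast
      then show False using L assms by auto
    qed
  qed
next
  assume R: "(b - a) * cnj (c - a) \<notin> \<real>\<^sub>\<ge>\<^sub>0"
  show "closed_segment a b \<inter> closed_segment a c \<subseteq> {a}"
  proof
    fix p assume "p \<in> closed_segment a b \<inter> closed_segment a c"
    then obtain u v where uv0: "0 \<le> u" "0 \<le> v" "p = (1 - u) *\<^sub>R a + u *\<^sub>R b" "p = (1 - v) *\<^sub>R a + v *\<^sub>R c"
      unfolding Int_iff in_segment by blast
    have uv: "0 \<le> u" "0 \<le> v" "p - a = of_real u * (b - a)" "p - a = of_real v * (c - a)"
      using uv0(1,2) by (simp_all, simp add: uv0(3) scaleR_conv_of_real algebra_simps,
        simp add: uv0(4) scaleR_conv_of_real algebra_simps)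
    show "p \<in> {a}"
    proof (rule ccontr)
      assume "p \<notin> {a}"
      then have "u \<noteq> 0" using uv by auto
      then have "b - a = of_real (v / u) * (c - a)" using uv(3,4) by (simp add: field_simps)
      then have "(b - a) * cnj (c - a) = of_real (v / u) * ((c - a) * cnj (c - a))" by (simp only: mult.assoc)
      also have "\<dots> = of_real (v / u * (cmod (c - a))\<^sup>2)" by (simp only: complex_norm_square of_real_mult)
      finally show False using R uv by (metis divide_nonneg_nonneg mult_nonneg_nonneg nonneg_Reals_of_real_iff zero_le_power2)
    qed
  qed
qed

lemma eventually_segments_common_end:
  fixes a b c :: complex
  assumes "(p \<longlongrightarrow> a) F" "(q \<longlongrightarrow> b) F" "(r \<longlongrightarrow> c) F"
    and "closed_segment a b \<inter> closed_segment a c \<subseteq> {a}" "a \<noteq> b" "a \<noteq> c"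
  shows "\<forall>\<^sub>F x in F. closed_segment (p x) (q x) \<inter> closed_segment (p x) (r x) \<subseteq> {p x}"
proof -
  have "((\<lambda>x. (q x - p x) * cnj (r x - p x)) \<longlongrightarrow> (b - a) * cnj (c - a)) F"
    by (intro tendsto_intros assms)
  moreover have "(b - a) * cnj (c - a) \<in> - \<real>\<^sub>\<ge>\<^sub>0" using segments_common_end_iff assms by auto
  ultimately have "\<forall>\<^sub>F x in F. (q x - p x) * cnj (r x - p x) \<in> - \<real>\<^sub>\<ge>\<^sub>0"
    by (rule topological_tendstoD[OF _ open_Compl[OF closed_nonneg_Reals_complex]])
  then show ?thesis
  proof eventually_elim
    case (elim x)
    \<comment> \<open>A degenerate segment would make the product \<open>0\<close>, which is a
      nonnegative real.\<close>
    then have "p x \<noteq> q x" "p x \<noteq> r x" by auto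
    then show ?case using elim segments_common_end_iff by auto
  qed
qed

text \<open>Disjoint compact segments have a positive distance \<open>e\<close>, and a point with
  fixed affine parameter moves by at most the sum of the displacements of the two ends.\<close>

lemma eventually_segments_disjoint:
  fixes a b c d :: complex
  assumes "(p \<longlongrightarrow> a) F" "(q \<longlongrightarrow> b) F" "(r \<longlongrightarrow> c) F" "(s \<longlongrightarrow> d) F"
    and "closed_segment a b \<inter> closed_segment c d = {}"
  shows "\<forall>\<^sub>F x in F. closed_segment (p x) (q x) \<inter> closed_segment (r x) (s x) = {}"
proof -
  obtain e where e: "e > 0" "\<And>x y. x \<in> closed_segment a b \<Longrightarrow> y \<in> closed_segment c d \<Longrightarrow> e \<le> dist x y"
    using separate_compact_closed[of "closed_segment a b" "closed_segment c d"] assms by auto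
  have "((\<lambda>x. norm (p x - a) + norm (q x - b) + norm (r x - c) + norm (s x - d)) \<longlongrightarrow>
      norm (a - a) + norm (b - b) + norm (c - c) + norm (d - d)) F"
    by (intro tendsto_intros assms)
  then have "\<forall>\<^sub>F x in F. norm (p x - a) + norm (q x - b) + norm (r x - c) + norm (s x - d) < e"
    using e(1) by (auto dest!: order_tendstoD(2)[where a = e])
  then show ?thesis
  proof eventually_elim
    case (elim x)
    show ?case
    proof (rule ccontr)
      assume "closed_segment (p x) (q x) \<inter> closed_segment (r x) (s x) \<noteq> {}"
      then obtain z where "z \<in> closed_segment (p x) (q x)" "z \<in> closed_segment (r x) (s x)" by blast
      then obtain u v where u: "0 \<le> u" "u \<le> 1" "z = (1 - u) *\<^sub>R p x + u *\<^sub>R q x"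
        and v: "0 \<le> v" "v \<le> 1" "z = (1 - v) *\<^sub>R r x + v *\<^sub>R s x"
        unfolding in_segment by blast
      have near: "norm (((1 - u) *\<^sub>R p' + u *\<^sub>R q') - ((1 - u) *\<^sub>R a' + u *\<^sub>R b')) \<le> norm (p' - a') + norm (q' - b')"
        if "0 \<le> u" "u \<le> 1" for u and p' q' a' b' :: complex
      proof -
        have "norm (((1 - u) *\<^sub>R p' + u *\<^sub>R q') - ((1 - u) *\<^sub>R a' + u *\<^sub>R b'))
            = norm ((1 - u) *\<^sub>R (p' - a') + u *\<^sub>R (q' - b'))" by (simp add: algebra_simps)
        also have "\<dots> \<le> (1 - u) * norm (p' - a') + u * norm (q' - b')"
          using that by (intro norm_triangle_le) simp
        also have "\<dots> \<le> norm (p' - a') + norm (q' - b')"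
          using that by (intro add_mono mult_left_le_one_le) auto
        finally show ?thesis .
      qed
      have "dist ((1 - u) *\<^sub>R a + u *\<^sub>R b) ((1 - v) *\<^sub>R c + v *\<^sub>R d)
          \<le> dist z ((1 - u) *\<^sub>R a + u *\<^sub>R b) + dist z ((1 - v) *\<^sub>R c + v *\<^sub>R d)"
        by (rule dist_triangle3)
      also have "\<dots> < e"
        using near[OF u(1,2), of "p x" "q x" a b] near[OF v(1,2), of "r x" "s x" c d] u(3) v(3) elim
        by (simp add: dist_norm)
      finally show False using e(2) u v unfolding in_segment by fastforce
    qed
  qed
qed

section \<open>Openness of simplicity\<close>

lemma simple_polygon_vertex_on_edge:
  assumes "simple_polygon P" "j < length P" "k < length P" "P ! j \<in> edge P k"
  shows "j = k \<or> j = Suc k mod length P"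
proof (cases "j = k")
  case False
  have "P ! j \<in> edge P j" by (simp add: edge_def)
  then have "P ! j \<in> {P ! k, P ! (Suc k mod length P)}"
    using assms False unfolding simple_polygon_def next_vertex_def by blast
  moreover have "Suc k mod length P < length P" using assms by (intro mod_less_divisor) linarith
  ultimately show ?thesis using assms by (auto simp: simple_polygon_def nth_eq_iff_index_eq)
qed simp

text \<open>Separates the two kinds of edge pairs that need different stability arguments: adjacent
  edges, which touch, and disjoint ones.\<close>

lemma simple_polygon_iff:
  "simple_polygon P \<longleftrightarrow> length P \<ge> 3 \<and> distinct P \<and>
     (\<forall>i<length P. edge P i \<inter> edge P (Suc i mod length P) \<subseteq> {next_vertex P i}) \<and>
     (\<forall>i<length P. \<forall>j<length P. i \<noteq> j \<longrightarrow> j \<noteq> Suc i mod length P \<longrightarrow> i \<noteq> Suc j mod length P \<longrightarrow>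
        edge P i \<inter> edge P j = {})" (is "_ \<longleftrightarrow> ?R")
proof
  let ?n = "length P"
  assume P: "simple_polygon P"
  then have n: "3 \<le> ?n" and dist: "distinct P"
    and meet: "\<And>i j. i < ?n \<Longrightarrow> j < ?n \<Longrightarrow> i \<noteq> j \<Longrightarrow>
        edge P i \<inter> edge P j \<subseteq> {P ! i, next_vertex P i} \<inter> {P ! j, next_vertex P j}"
    unfolding simple_polygon_def by blast+
  have "edge P i \<inter> edge P (Suc i mod ?n) \<subseteq> {next_vertex P i}" if "i < ?n" for i
  proof -
    \<comment> \<open>That the second successor of \<open>i\<close> differs from \<open>i\<close>
      needs three vertices; it makes the shared endpoint of adjacent edges unique.\<close>
    have "Suc i mod ?n < ?n" "Suc i mod ?n \<noteq> i" "Suc (Suc i mod ?n) mod ?n \<noteq> i" "Suc (Suc i mod ?n) mod ?n < ?n"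
      using n that by (auto simp: mod_Suc)
    then show ?thesis
      using meet[of i "Suc i mod ?n"] that dist by (auto simp: next_vertex_def nth_eq_iff_index_eq)
  qed
  moreover have "edge P i \<inter> edge P j = {}"
    if "i < ?n" "j < ?n" "i \<noteq> j" "j \<noteq> Suc i mod ?n" "i \<noteq> Suc j mod ?n" for i j
  proof -
    have "Suc i mod ?n < ?n" "Suc j mod ?n < ?n" "Suc i mod ?n \<noteq> Suc j mod ?n"
      using n that by (auto simp: mod_Suc)
    then have "{P ! i, next_vertex P i} \<inter> {P ! j, next_vertex P j} = {}"
      using that dist by (auto simp: next_vertex_def nth_eq_iff_index_eq)
    then show ?thesis using meet that by blast
  qed
  ultimately show ?R using n dist by blast
next
  assume R: ?R
  have "edge P i \<inter> edge P j \<subseteq> {P ! i, next_vertex P i} \<inter> {P ! j, next_vertex P j}"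
    if "i < length P" "j < length P" "i \<noteq> j" for i j
  proof -
    consider "j = Suc i mod length P" | "i = Suc j mod length P"
      | "j \<noteq> Suc i mod length P" "i \<noteq> Suc j mod length P" by blast
    then show ?thesis
    proof cases
      case 1
      then have "edge P i \<inter> edge P j \<subseteq> {next_vertex P i}" using R that by blast
      then show ?thesis using 1 by (auto simp: next_vertex_def)
    next
      case 2
      then have "edge P j \<inter> edge P i \<subseteq> {next_vertex P j}" using R that by blast
      then show ?thesis using 2 by (auto simp: next_vertex_def)
    next
      case 3
      then show ?thesis using R that by blast
    qed
  qed
  moreover have "3 \<le> length P" "distinct P" using R by blast+
  ultimately show "simple_polygon P" by (simp add: simple_polygon_def)
qed

lemma eventually_simple_polygon:
  assumes P: "simple_polygon P"
    and len: "\<forall>\<^sub>F x in F. length (Q x) = length P"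
    and lim: "\<And>i. i < length P \<Longrightarrow> ((\<lambda>x. Q x ! i) \<longlongrightarrow> P ! i) F"
  shows "\<forall>\<^sub>F x in F. length (Q x) = length P \<and> simple_polygon (Q x)"
proof -
  let ?n = "length P"
  have n: "3 \<le> ?n" and dist: "distinct P" using P by (auto simp: simple_polygon_def)
  have suc: "Suc i mod ?n < ?n" for i using n by (intro mod_less_divisor) linarith
  have "\<forall>\<^sub>F x in F. \<forall>i\<in>{..<?n}. \<forall>j\<in>{..<?n}. i \<noteq> j \<longrightarrow> Q x ! i \<noteq> Q x ! j"
  proof (intro eventually_ball_finite ballI finite_lessThan)
    fix i j assume "i \<in> {..<?n}" "j \<in> {..<?n}"
    then have "i \<noteq> j \<Longrightarrow> P ! i - P ! j \<noteq> 0"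
      "((\<lambda>x. Q x ! i - Q x ! j) \<longlongrightarrow> P ! i - P ! j) F"
      using dist by (auto simp: nth_eq_iff_index_eq intro!: tendsto_intros lim)
    then have "i \<noteq> j \<Longrightarrow> \<forall>\<^sub>F x in F. Q x ! i - Q x ! j \<noteq> 0" using tendsto_imp_eventually_ne by blast
    then show "\<forall>\<^sub>F x in F. i \<noteq> j \<longrightarrow> Q x ! i \<noteq> Q x ! j" by (cases "i = j") auto
  qed
  moreover have "\<forall>\<^sub>F x in F. \<forall>i\<in>{..<?n}.
      closed_segment (Q x ! i) (Q x ! (Suc i mod ?n)) \<inter>
      closed_segment (Q x ! (Suc i mod ?n)) (Q x ! (Suc (Suc i mod ?n) mod ?n)) \<subseteq> {Q x ! (Suc i mod ?n)}"
  proof (intro eventually_ball_finite ballI finite_lessThan)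
    fix i assume "i \<in> {..<?n}"
    then have i: "i < ?n" by simp
    have "edge P i \<inter> edge P (Suc i mod ?n) \<subseteq> {next_vertex P i}" using P i by (simp add: simple_polygon_iff)
    \<comment> \<open>Both edges are written as starting from the shared vertex, the form of the
      direction criterion.\<close>
    then have "closed_segment (P ! (Suc i mod ?n)) (P ! i) \<inter>
      closed_segment (P ! (Suc i mod ?n)) (P ! (Suc (Suc i mod ?n) mod ?n)) \<subseteq> {P ! (Suc i mod ?n)}"
      by (simp add: edge_def next_vertex_def closed_segment_commute)
    moreover have "P ! (Suc i mod ?n) \<noteq> P ! i" "P ! (Suc i mod ?n) \<noteq> P ! (Suc (Suc i mod ?n) mod ?n)"
      using next_vertex_neq[OF P] i suc unfolding next_vertex_def by metis+
    ultimately have "\<forall>\<^sub>F x in F. closed_segment (Q x ! (Suc i mod ?n)) (Q x ! i) \<inter>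
        closed_segment (Q x ! (Suc i mod ?n)) (Q x ! (Suc (Suc i mod ?n) mod ?n)) \<subseteq> {Q x ! (Suc i mod ?n)}"
      by (intro eventually_segments_common_end[OF lim lim lim] suc i)
    then show "\<forall>\<^sub>F x in F. closed_segment (Q x ! i) (Q x ! (Suc i mod ?n)) \<inter>
        closed_segment (Q x ! (Suc i mod ?n)) (Q x ! (Suc (Suc i mod ?n) mod ?n)) \<subseteq> {Q x ! (Suc i mod ?n)}"
      by (simp add: closed_segment_commute)
  qed
  moreover have "\<forall>\<^sub>F x in F. \<forall>i\<in>{..<?n}. \<forall>j\<in>{..<?n}.
      i \<noteq> j \<and> j \<noteq> Suc i mod ?n \<and> i \<noteq> Suc j mod ?n \<longrightarrow>
      closed_segment (Q x ! i) (Q x ! (Suc i mod ?n)) \<inter> closed_segment (Q x ! j) (Q x ! (Suc j mod ?n)) = {}"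
  proof (intro eventually_ball_finite ballI finite_lessThan)
    fix i j assume ij: "i \<in> {..<?n}" "j \<in> {..<?n}"
    show "\<forall>\<^sub>F x in F. i \<noteq> j \<and> j \<noteq> Suc i mod ?n \<and> i \<noteq> Suc j mod ?n \<longrightarrow>
      closed_segment (Q x ! i) (Q x ! (Suc i mod ?n)) \<inter> closed_segment (Q x ! j) (Q x ! (Suc j mod ?n)) = {}"
    proof (cases "i \<noteq> j \<and> j \<noteq> Suc i mod ?n \<and> i \<noteq> Suc j mod ?n")
      case True
      then have "closed_segment (P ! i) (P ! (Suc i mod ?n)) \<inter> closed_segment (P ! j) (P ! (Suc j mod ?n)) = {}"
        using P ij unfolding simple_polygon_iff edge_def next_vertex_def by blast
      then have "\<forall>\<^sub>F x in F. closed_segment (Q x ! i) (Q x ! (Suc i mod ?n)) \<inter>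
          closed_segment (Q x ! j) (Q x ! (Suc j mod ?n)) = {}"
        using ij by (intro eventually_segments_disjoint[OF lim lim lim lim] suc) auto
      then show ?thesis by (rule eventually_mono) blast
    next
      case False
      then show ?thesis by (intro always_eventually) blast
    qed
  qed
  ultimately show ?thesis using len
  proof eventually_elim
    case (elim x)
    then have "distinct (Q x)" by (auto simp: distinct_conv_nth)
    with elim n show ?case unfolding simple_polygon_iff edge_def next_vertex_def by auto
  qed
qed

text \<open>An open segment is connected, so if it misses the boundary it lies entirely inside or
  entirely outside, and any one of its points tells which. The midpoint is a convenient choice
  because it varies linearly with the two vertices.\<close>

lemma visible_iff:
  assumes P: "simple_polygon P" and ij: "i < length P" "j < length P"
  shows "visible P (P ! i) (P ! j) \<longleftrightarrow> i \<noteq> j \<and>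
    (\<forall>k<length P. open_segment (P ! i) (P ! j) \<inter> edge P k = {}) \<and>
    midpoint (P ! i) (P ! j) \<in> polygon_interior P" (is "?L \<longleftrightarrow> ?R")
proof (cases "i = j")
  case False
  then have ne: "P ! i \<noteq> P ! j" using P ij by (auto simp: simple_polygon_def nth_eq_iff_index_eq)
  have reg: "P ! k \<in> polygon_region P" if "k < length P" for k
    using that by (auto simp: polygon_region_def polygon_boundary_def edge_def)
  let ?S = "open_segment (P ! i) (P ! j)"
  have mid: "midpoint (P ! i) (P ! j) \<in> ?S" using ne by (simp add: midpoint_in_open_segment)
  have "?S \<subseteq> polygon_interior P \<longleftrightarrow> ?S \<inter> polygon_boundary P = {} \<and> midpoint (P ! i) (P ! j) \<in> polygon_interior P"
  proof safe
    fix z assume "?S \<inter> polygon_boundary P = {}" "midpoint (P ! i) (P ! j) \<in> polygon_interior P" "z \<in> ?S"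
    moreover have "connected ?S" by (simp add: convex_connected)
    ultimately show "z \<in> polygon_interior P"
      using mid inside_same_component[of "polygon_boundary P" "midpoint (P ! i) (P ! j)" z]
      unfolding polygon_interior_def connected_component_def by blast
  next
    fix z assume "?S \<subseteq> polygon_interior P" "z \<in> ?S" "z \<in> polygon_boundary P"
    then show "z \<in> {}" using inside_no_overlap[of "polygon_boundary P"] unfolding polygon_interior_def by blast
  qed (use mid in blast)
  then show ?thesis using ne False reg ij by (auto simp: visible_def polygon_boundary_def)
qed (simp add: visible_def)

lemma eventually_visible:
  assumes P: "simple_polygon P" and ij: "i < length P" "j < length P"
    and vis: "visible P (P ! i) (P ! j)"
    and len: "\<forall>\<^sub>F x in F. length (Q x) = length P"
    and lim: "\<And>i. i < length P \<Longrightarrow> ((\<lambda>x. Q x ! i) \<longlongrightarrow> P ! i) F"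
  shows "\<forall>\<^sub>F x in F. visible (Q x) (Q x ! i) (Q x ! j)"
proof -
  let ?n = "length P"
  have n: "3 \<le> ?n" and dist: "distinct P" using P by (auto simp: simple_polygon_def)
  have suc: "Suc i mod ?n < ?n" for i using n by (intro mod_less_divisor) linarith
  have simp: "\<forall>\<^sub>F x in F. length (Q x) = length P \<and> simple_polygon (Q x)"
    by (rule eventually_simple_polygon[OF P len lim])
  have V: "i \<noteq> j" "\<And>k. k < ?n \<Longrightarrow> open_segment (P ! i) (P ! j) \<inter> edge P k = {}"
    "midpoint (P ! i) (P ! j) \<in> polygon_interior P"
    using vis[unfolded visible_iff[OF P ij]] by blast+
  have ne: "P ! i \<noteq> P ! j" using V(1) dist ij by (simp add: nth_eq_iff_index_eq)
  \<comment> \<open>The chord from \<open>a\<close> to \<open>b\<close> against an edge at its own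
    end \<open>a\<close>: the closed segments meet in \<open>P ! a\<close>, so the direction
    criterion replaces positive distance.\<close>
  have corner: "\<forall>\<^sub>F x in F. open_segment (Q x ! a) (Q x ! b) \<inter> closed_segment (Q x ! a) (Q x ! c) = {}"
    if abc: "a < ?n" "b < ?n" "c < ?n" "a \<noteq> b" "a \<noteq> c" "b \<noteq> c"
      and k: "k < ?n" "edge P k = closed_segment (P ! a) (P ! c)" "{a, c} = {k, Suc k mod ?n}"
      and op: "open_segment (P ! a) (P ! b) \<inter> edge P k = {}" for a b c k
  proof -
    have "P ! b \<notin> edge P k" using simple_polygon_vertex_on_edge[OF P abc(2) k(1)] abc(4,6) k(3) by (metis insertCI insertE singletonD)
    then have "closed_segment (P ! a) (P ! b) \<inter> closed_segment (P ! a) (P ! c) \<subseteq> {P ! a}"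
      using op k(2) closed_segment_eq_open[of "P ! a" "P ! b"] by blast
    then have "\<forall>\<^sub>F x in F. closed_segment (Q x ! a) (Q x ! b) \<inter> closed_segment (Q x ! a) (Q x ! c) \<subseteq> {Q x ! a}"
      using abc dist by (intro eventually_segments_common_end[OF lim lim lim]) (auto simp: nth_eq_iff_index_eq)
    then show ?thesis by (rule eventually_mono) (auto simp: open_segment_def)
  qed
  have "\<forall>\<^sub>F x in F. \<forall>k\<in>{..<?n}. open_segment (Q x ! i) (Q x ! j) \<inter>
      closed_segment (Q x ! k) (Q x ! (Suc k mod ?n)) = {}"
  proof (intro eventually_ball_finite ballI finite_lessThan)
    fix k assume "k \<in> {..<?n}"
    then have k: "k < ?n" by simp
    let ?k = "Suc k mod ?n"
    have kk: "k \<noteq> ?k" using k n by (auto simp: mod_Suc)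
    have e: "edge P k = closed_segment (P ! k) (P ! ?k)" by (simp add: edge_def next_vertex_def)
    \<comment> \<open>A visible pair never spans an edge, whose midpoint would lie on the boundary.
      Hence chord and edge share at most one end.\<close>
    have nadj: "{i, j} \<noteq> {k, ?k}"
    proof
      assume "{i, j} = {k, ?k}"
      then have "closed_segment (P ! i) (P ! j) = edge P k"
        unfolding e by (auto simp: doubleton_eq_iff closed_segment_commute)
      then have "midpoint (P ! i) (P ! j) \<in> open_segment (P ! i) (P ! j) \<inter> edge P k"
        using ne midpoint_in_open_segment segment_open_subset_closed by fastforce
      then show False using V(2)[OF k] by blast
    qed
    consider "i = k" | "i = ?k" | "j = k" | "j = ?k" | "i \<noteq> k" "i \<noteq> ?k" "j \<noteq> k" "j \<noteq> ?k" by blast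
    then show "\<forall>\<^sub>F x in F. open_segment (Q x ! i) (Q x ! j) \<inter> closed_segment (Q x ! k) (Q x ! ?k) = {}"
    proof cases
      case 1
      then have "j \<noteq> ?k" using nadj by blast
      have "\<forall>\<^sub>F x in F. open_segment (Q x ! i) (Q x ! j) \<inter> closed_segment (Q x ! i) (Q x ! ?k) = {}"
        by (rule corner[where k = k])
          (use 1 \<open>j \<noteq> ?k\<close> ij suc k kk V(1) V(2)[OF k] in \<open>simp_all add: e insert_commute
            closed_segment_commute open_segment_commute\<close>)
      then show ?thesis using 1 by (simp add: closed_segment_commute open_segment_commute)
    next
      case 2
      then have "j \<noteq> k" using nadj by blast
      have "\<forall>\<^sub>F x in F. open_segment (Q x ! i) (Q x ! j) \<inter> closed_segment (Q x ! i) (Q x ! k) = {}"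
        by (rule corner[where k = k])
          (use 2 \<open>j \<noteq> k\<close> ij suc k kk V(1) V(2)[OF k] in \<open>simp_all add: e insert_commute
            closed_segment_commute open_segment_commute\<close>)
      then show ?thesis using 2 by (simp add: closed_segment_commute open_segment_commute)
    next
      case 3
      then have "i \<noteq> ?k" using nadj by blast
      have "\<forall>\<^sub>F x in F. open_segment (Q x ! j) (Q x ! i) \<inter> closed_segment (Q x ! j) (Q x ! ?k) = {}"
        by (rule corner[where k = k])
          (use 3 \<open>i \<noteq> ?k\<close> ij suc k kk V(1) V(2)[OF k] in \<open>simp_all add: e insert_commute
            closed_segment_commute open_segment_commute\<close>)
      then show ?thesis using 3 by (simp add: closed_segment_commute open_segment_commute)
    next
      case 4
      then have "i \<noteq> k" using nadj by blast
      have "\<forall>\<^sub>F x in F. open_segment (Q x ! j) (Q x ! i) \<inter> closed_segment (Q x ! j) (Q x ! k) = {}"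
        by (rule corner[where k = k])
          (use 4 \<open>i \<noteq> k\<close> ij suc k kk V(1) V(2)[OF k] in \<open>simp_all add: e insert_commute
            closed_segment_commute open_segment_commute\<close>)
      then show ?thesis using 4 by (simp add: closed_segment_commute open_segment_commute)
    next
      case 5
      then have "P ! i \<notin> edge P k" "P ! j \<notin> edge P k"
        using simple_polygon_vertex_on_edge[OF P _ k] ij by blast+
      then have "closed_segment (P ! i) (P ! j) \<inter> closed_segment (P ! k) (P ! ?k) = {}"
        using V(2)[OF k] e closed_segment_eq_open[of "P ! i" "P ! j"] by blast
      then have "\<forall>\<^sub>F x in F. closed_segment (Q x ! i) (Q x ! j) \<inter> closed_segment (Q x ! k) (Q x ! ?k) = {}"
        using ij k suc by (intro eventually_segments_disjoint[OF lim lim lim lim])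
      then show ?thesis by (rule eventually_mono) (auto simp: open_segment_def)
    qed
  qed
  moreover have "\<forall>\<^sub>F x in F. midpoint (Q x ! i) (Q x ! j) \<in> polygon_interior (Q x) \<longleftrightarrow>
      midpoint (P ! i) (P ! j) \<in> polygon_interior P"
  proof (rule eventually_polygon_interior[OF P _ simp lim])
    show "midpoint (P ! i) (P ! j) \<notin> polygon_boundary P"
      using V(3) inside_no_overlap[of "polygon_boundary P"] unfolding polygon_interior_def by blast
    show "((\<lambda>x. midpoint (Q x ! i) (Q x ! j)) \<longlongrightarrow> midpoint (P ! i) (P ! j)) F"
      unfolding midpoint_def by (intro tendsto_intros lim ij)
  qed
  ultimately show ?thesis using simp
  proof eventually_elim
    case (elim x)
    then show ?case using visible_iff[of "Q x" i j] ij V by (simp add: edge_def next_vertex_def)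
  qed
qed

section \<open>Eventual constancy of visibility along polynomial motions\<close>

definition polyfun :: "(real \<Rightarrow> real) \<Rightarrow> bool" where
  "polyfun f \<longleftrightarrow> (\<exists>p. f = poly p)"

lemma polyfun_const: "polyfun (\<lambda>t. c)"
  unfolding polyfun_def by (rule exI[of _ "[:c:]"]) auto

lemma polyfun_ident: "polyfun (\<lambda>t. t)"
  unfolding polyfun_def by (rule exI[of _ "[:0, 1:]"]) auto

lemma polyfun_add: "polyfun f \<Longrightarrow> polyfun g \<Longrightarrow> polyfun (\<lambda>t. f t + g t)"
  unfolding polyfun_def by (elim exE, rename_tac p q, rule_tac x = "p + q" in exI) (simp add: fun_eq_iff)

lemma polyfun_diff: "polyfun f \<Longrightarrow> polyfun g \<Longrightarrow> polyfun (\<lambda>t. f t - g t)"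
  unfolding polyfun_def by (elim exE, rename_tac p q, rule_tac x = "p - q" in exI) (simp add: fun_eq_iff)

lemma polyfun_mult: "polyfun f \<Longrightarrow> polyfun g \<Longrightarrow> polyfun (\<lambda>t. f t * g t)"
  unfolding polyfun_def by (elim exE, rename_tac p q, rule_tac x = "p * q" in exI) (simp add: fun_eq_iff)

lemmas polyfun_intros = polyfun_const polyfun_ident polyfun_add polyfun_diff polyfun_mult

lemma polyfun_continuous: "polyfun f \<Longrightarrow> (f \<longlongrightarrow> f a) (at a within A)"
  unfolding polyfun_def by (auto intro!: tendsto_intros)

text \<open>Split off the full power of the root \<open>s\<close>. To the right of \<open>s\<close>
  this factor is positive, so the sign is that of the cofactor at \<open>s\<close>, where it does
  not vanish.\<close>

lemma polyfun_sgn_at_right: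
  assumes "polyfun f"
  obtains c where "\<forall>\<^sub>F t in at_right s. sgn (f t) = c"
proof -
  obtain p where p: "f = poly p" using assms by (auto simp: polyfun_def)
  show ?thesis
  proof (cases "p = 0")
    case True
    then have "\<forall>\<^sub>F t in at_right s. sgn (f t) = 0" using p by simp
    then show ?thesis by (rule that)
  next
    case False
    then obtain k q where q: "p = [:- s, 1:] ^ k * q" "poly q s \<noteq> 0"
      unfolding poly_eq_0_iff_dvd using order_decomp[OF False, of s] by blast
    have lim: "(poly q \<longlongrightarrow> poly q s) (at_right s)"
      by (rule polyfun_continuous) (auto simp: polyfun_def)
    have "\<forall>\<^sub>F t in at_right s. sgn (poly q t) = sgn (poly q s)"
    proof (cases "poly q s > 0")
      case True
      then show ?thesis using order_tendstoD(1)[OF lim True] by (elim eventually_mono) simp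
    next
      case False
      then have "poly q s < 0" using q(2) by simp
      then show ?thesis using order_tendstoD(2)[OF lim, of 0] by (auto elim: eventually_mono)
    qed
    moreover have "\<forall>\<^sub>F t in at_right s. t > s" by (simp add: eventually_at_right_less)
    ultimately have "\<forall>\<^sub>F t in at_right s. sgn (f t) = sgn (poly q s)"
      by eventually_elim (simp add: p q(1) sgn_mult)
    then show ?thesis by (rule that)
  qed
qed

text \<open>Excludes oscillation along the filter. Unlike eventual truth alone, this notion is
  closed under negation, hence under all Boolean combinations.\<close>

definition decided :: "('a \<Rightarrow> bool) \<Rightarrow> 'a filter \<Rightarrow> bool" where
  "decided Q F \<longleftrightarrow> (\<forall>\<^sub>F x in F. Q x) \<or> (\<forall>\<^sub>F x in F. \<not> Q x)"

lemma decided_not: "decided Q F \<Longrightarrow> decided (\<lambda>x. \<not> Q x) F"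
  by (auto simp: decided_def)

lemma decided_conj: "decided Q F \<Longrightarrow> decided R F \<Longrightarrow> decided (\<lambda>x. Q x \<and> R x) F"
  unfolding decided_def eventually_conj_iff by (blast intro: eventually_mono)

lemma decided_disj: "decided Q F \<Longrightarrow> decided R F \<Longrightarrow> decided (\<lambda>x. Q x \<or> R x) F"
  using decided_not[OF decided_conj[OF decided_not decided_not, of Q F R]] by simp

lemma decided_polyfun_less:
  assumes "polyfun f" "polyfun g"
  shows "decided (\<lambda>t. f t < g t) (at_right s)"
proof -
  obtain c where c: "\<forall>\<^sub>F t in at_right s. sgn (g t - f t) = c"
    using polyfun_sgn_at_right[OF polyfun_diff[OF assms(2,1)]] by blast
  show ?thesis
  proof (cases "c = 1")
    case True
    then have "\<forall>\<^sub>F t in at_right s. f t < g t"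
      using c by (elim eventually_mono) (simp add: sgn_1_pos)
    then show ?thesis by (simp add: decided_def)
  next
    case False
    then have "\<forall>\<^sub>F t in at_right s. \<not> f t < g t"
      using c by (elim eventually_mono) (auto simp: sgn_if)
    then show ?thesis by (simp add: decided_def)
  qed
qed

lemma decided_polyfun_le: "polyfun f \<Longrightarrow> polyfun g \<Longrightarrow> decided (\<lambda>t. f t \<le> g t) (at_right s)"
  using decided_not[OF decided_polyfun_less[of g f s]] by (simp add: not_less)

lemma decided_polyfun_eq: "polyfun f \<Longrightarrow> polyfun g \<Longrightarrow> decided (\<lambda>t. f t = g t) (at_right s)"
  using decided_conj[OF decided_polyfun_le[of f g s] decided_polyfun_le[of g f s]]
  by (simp add: order_eq_iff)

lemmas decided_intros = decided_not decided_conj decided_disj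
  decided_polyfun_less decided_polyfun_le decided_polyfun_eq polyfun_intros

text \<open>
  The first disjunct evaluates the chord at its zero \<open>v = \<alpha> / (\<alpha> - \<beta>)\<close>, with denominators cleared
  so that only polynomial inequalities remain.
\<close>

lemma chord_meets_interval_iff:
  fixes L :: real
  assumes L: "0 < L"
  shows "(\<exists>v. 0 \<le> v \<and> v \<le> 1 \<and> (1 - v) * \<alpha> + v * \<beta> = 0 \<and>
            0 < (1 - v) * \<gamma> + v * \<delta> \<and> (1 - v) * \<gamma> + v * \<delta> < L) \<longleftrightarrow>
    (\<alpha> \<noteq> \<beta> \<and> 0 \<le> \<alpha> * (\<alpha> - \<beta>) \<and> \<alpha> * (\<alpha> - \<beta>) \<le> (\<alpha> - \<beta>) * (\<alpha> - \<beta>) \<and>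
      0 < (\<alpha> * \<delta> - \<beta> * \<gamma>) * (\<alpha> - \<beta>) \<and>
      (\<alpha> * \<delta> - \<beta> * \<gamma>) * (\<alpha> - \<beta>) < L * ((\<alpha> - \<beta>) * (\<alpha> - \<beta>))) \<or>
    (\<alpha> = 0 \<and> \<beta> = 0 \<and> (\<gamma> < L \<or> \<delta> < L) \<and> (0 < \<gamma> \<or> 0 < \<delta>))"
    (is "?L \<longleftrightarrow> ?A \<or> ?B")
proof (cases "\<alpha> = \<beta>")
  case False
  define D where "D = \<alpha> - \<beta>"
  have D: "D \<noteq> 0" "0 < D * D" using False by (auto simp: D_def zero_less_mult_iff)
  have root: "(1 - v) * \<alpha> + v * \<beta> = 0 \<longleftrightarrow> v = \<alpha> / D" for v
    using D by (auto simp: field_simps D_def)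
  have val: "(1 - \<alpha> / D) * \<gamma> + \<alpha> / D * \<delta> = (\<alpha> * \<delta> - \<beta> * \<gamma>) / D"
    using D by (simp add: field_simps D_def)
  have pos: "0 \<le> x / D \<longleftrightarrow> 0 \<le> x * D" "0 < x / D \<longleftrightarrow> 0 < x * D" for x
    by (auto simp: zero_le_divide_iff zero_le_mult_iff zero_less_divide_iff zero_less_mult_iff)
  have upper: "x / D \<le> y \<longleftrightarrow> x * D \<le> y * (D * D)" "x / D < y \<longleftrightarrow> x * D < y * (D * D)" for x y
  proof -
    have "x / D = x * D / (D * D)" using D by simp
    then show "x / D \<le> y \<longleftrightarrow> x * D \<le> y * (D * D)" "x / D < y \<longleftrightarrow> x * D < y * (D * D)"
      by (simp_all only: pos_divide_le_eq[OF D(2)] pos_divide_less_eq[OF D(2)])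
  qed
  have "?L \<longleftrightarrow> 0 \<le> \<alpha> / D \<and> \<alpha> / D \<le> 1 \<and>
      0 < (1 - \<alpha> / D) * \<gamma> + \<alpha> / D * \<delta> \<and> (1 - \<alpha> / D) * \<gamma> + \<alpha> / D * \<delta> < L"
    unfolding root by blast
  then have "?L \<longleftrightarrow> ?A"
    unfolding val pos upper D_def[symmetric] mult_1 using False by blast
  then show ?thesis using False by blast
next
  case True
  \<comment> \<open>Here the first coordinate is constantly \<open>\<alpha>\<close>, so it must
    vanish, and the segment runs along the axis from \<open>\<gamma>\<close> to
    \<open>\<delta>\<close>. It misses the open interval from \<open>0\<close> to \<open>L\<close>
    exactly when both ends are at most \<open>0\<close> or both are at least
    \<open>L\<close>.\<close>
  have if_part: "?L" if h: "\<alpha> = 0" "\<gamma> < L \<or> \<delta> < L" "0 < \<gamma> \<or> 0 < \<delta>"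
  proof -
    have z: "\<alpha> = 0" "\<beta> = 0" using True h(1) by simp_all
    consider "0 < \<gamma>" "\<gamma> < L" | "0 < \<delta>" "\<delta> < L" | "\<gamma> \<le> 0" "L \<le> \<delta>" | "\<delta> \<le> 0" "L \<le> \<gamma>"
      using h(2,3) L by linarith
    then show ?thesis
    proof cases
      case 1
      then show ?thesis by (intro exI[of _ 0]) (simp add: z)
    next
      case 2
      then show ?thesis by (intro exI[of _ 1]) (simp add: z)
    next
      case 3
      \<comment> \<open>The ends lie on opposite sides of the interval; \<open>v\<close> is the
        parameter at which the value is its centre \<open>L / 2\<close>.\<close>
      define v where "v = (L / 2 - \<gamma>) / (\<delta> - \<gamma>)"
      have "v * (\<delta> - \<gamma>) = L / 2 - \<gamma>" using 3 L by (simp add: v_def)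
      then have "(1 - v) * \<gamma> + v * \<delta> = L / 2" by (simp add: algebra_simps)
      moreover have "0 \<le> v" "v \<le> 1"
        unfolding v_def using 3 L by (simp_all add: divide_le_eq)
      ultimately show ?thesis using L by (intro exI[of _ v]) (simp add: z)
    next
      case 4
      define v where "v = (\<gamma> - L / 2) / (\<gamma> - \<delta>)"
      have "v * (\<gamma> - \<delta>) = \<gamma> - L / 2" using 4 L by (simp add: v_def)
      then have "(1 - v) * \<gamma> + v * \<delta> = L / 2" by (simp add: algebra_simps)
      moreover have "0 \<le> v" "v \<le> 1"
        unfolding v_def using 4 L by (simp_all add: divide_le_eq)
      ultimately show ?thesis using L by (intro exI[of _ v]) (simp add: z)
    qed
  qed
  have only_if: "\<alpha> = 0 \<and> (\<gamma> < L \<or> \<delta> < L) \<and> (0 < \<gamma> \<or> 0 < \<delta>)" if ex: "?L"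
  proof -
    obtain v where v: "0 \<le> v" "v \<le> 1" "(1 - v) * \<alpha> + v * \<beta> = 0"
      "0 < (1 - v) * \<gamma> + v * \<delta>" "(1 - v) * \<gamma> + v * \<delta> < L" using ex by blast
    have "(1 - v) * \<alpha> + v * \<alpha> = \<alpha>" by (simp add: algebra_simps)
    then have "\<alpha> = 0" using v(3) unfolding True by simp
    moreover have "0 < \<gamma> \<or> 0 < \<delta>"
    proof (rule ccontr)
      assume "\<not> (0 < \<gamma> \<or> 0 < \<delta>)"
      then have "(1 - v) * \<gamma> \<le> 0" "v * \<delta> \<le> 0" using v(1,2) by (intro mult_nonneg_nonpos; simp)+
      then show False using v(4) by linarith
    qed
    moreover have "\<gamma> < L \<or> \<delta> < L"
    proof (rule ccontr)
      assume "\<not> (\<gamma> < L \<or> \<delta> < L)"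
      then have "(1 - v) * \<gamma> \<ge> (1 - v) * L" "v * \<delta> \<ge> v * L" using v(1,2) by (intro mult_left_mono; simp)+
      moreover have "(1 - v) * L + v * L = L" by (simp add: algebra_simps)
      ultimately show False using v(5) by linarith
    qed
    ultimately show ?thesis by blast
  qed
  have B: "?B \<longleftrightarrow> \<alpha> = 0 \<and> (\<gamma> < L \<or> \<delta> < L) \<and> (0 < \<gamma> \<or> 0 < \<delta>)" unfolding True by blast
  have "?L \<longleftrightarrow> ?B" unfolding B using if_part only_if by blast
  then show ?thesis using True by simp
qed

lemma Re_complex_of_real_mult: "Re (of_real r * z) = r * Re z"
  and Im_complex_of_real_mult: "Im (of_real r * z) = r * Im z"
  by simp_all

text \<open>
  Multiplication by \<open>cnj (b - a)\<close> after translation by \<open>- a\<close> maps the segment from \<open>a\<close> to \<open>b\<close> onto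
  the real interval from \<open>0\<close> to \<open>(cmod (b - a))\<^sup>2\<close>.
\<close>

lemma segments_meet_iff:
  fixes a b c d :: complex
  assumes "a \<noteq> b"
  shows "open_segment a b \<inter> closed_segment c d \<noteq> {} \<longleftrightarrow>
    (\<exists>v. 0 \<le> v \<and> v \<le> 1 \<and>
      (1 - v) * Im ((c - a) * cnj (b - a)) + v * Im ((d - a) * cnj (b - a)) = 0 \<and>
      0 < (1 - v) * Re ((c - a) * cnj (b - a)) + v * Re ((d - a) * cnj (b - a)) \<and>
      (1 - v) * Re ((c - a) * cnj (b - a)) + v * Re ((d - a) * cnj (b - a)) < (cmod (b - a))\<^sup>2)"
proof -
  have on: "p \<in> open_segment a b \<longleftrightarrow> Im ((p - a) * cnj (b - a)) = 0 \<and>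
      0 < Re ((p - a) * cnj (b - a)) \<and> Re ((p - a) * cnj (b - a)) < (cmod (b - a))\<^sup>2" for p
  proof -
    define L where "L = (cmod (b - a))\<^sup>2"
    have L: "0 < L" "(b - a) * cnj (b - a) = of_real L"
      using assms by (simp add: L_def, simp only: L_def complex_norm_square)
    have "p = (1 - u) *\<^sub>R a + u *\<^sub>R b \<longleftrightarrow> (p - a) * cnj (b - a) = of_real (u * L)" for u
    proof -
      have "p = (1 - u) *\<^sub>R a + u *\<^sub>R b \<longleftrightarrow> p - a = of_real u * (b - a)"
        by (auto simp: scaleR_conv_of_real algebra_simps)
      also have "\<dots> \<longleftrightarrow> (p - a) * cnj (b - a) = of_real u * (b - a) * cnj (b - a)" using assms by simp
      finally show ?thesis by (simp only: mult.assoc L(2) of_real_mult)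
    qed
    then have "p \<in> open_segment a b \<longleftrightarrow> (\<exists>u. 0 < u \<and> u < 1 \<and> (p - a) * cnj (b - a) = of_real (u * L))"
      using assms by (simp only: in_segment) simp
    also have "\<dots> \<longleftrightarrow> Im ((p - a) * cnj (b - a)) = 0 \<and>
        0 < Re ((p - a) * cnj (b - a)) \<and> Re ((p - a) * cnj (b - a)) < L" (is "?E \<longleftrightarrow> ?C")
    proof
      assume ?E
      then obtain u where "0 < u" "u < 1" and u: "(p - a) * cnj (b - a) = of_real (u * L)" by blast
      then show ?C using L(1) unfolding u by simp
    next
      define z where "z = (p - a) * cnj (b - a)"
      assume ?C
      then have C: "Im z = 0" "0 < Re z" "Re z < L" by (simp_all only: z_def)
      have "z = of_real (Re z / L * L)" "0 < Re z / L" "Re z / L < 1"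
        using C L(1) by (simp_all add: complex_eq_iff)
      then show ?E unfolding z_def by blast
    qed
    finally show ?thesis by (simp add: L_def)
  qed
  have comb: "((1 - v) *\<^sub>R c + v *\<^sub>R d - a) * cnj (b - a)
      = of_real (1 - v) * ((c - a) * cnj (b - a)) + of_real v * ((d - a) * cnj (b - a))" for v
    by (simp add: scaleR_conv_of_real algebra_simps)
  have "open_segment a b \<inter> closed_segment c d \<noteq> {} \<longleftrightarrow>
      (\<exists>v. 0 \<le> v \<and> v \<le> 1 \<and> (1 - v) *\<^sub>R c + v *\<^sub>R d \<in> open_segment a b)"
  proof -
    have "open_segment a b \<inter> closed_segment c d \<noteq> {} \<longleftrightarrow> (\<exists>p. p \<in> closed_segment c d \<and> p \<in> open_segment a b)"
      by blast
    then show ?thesis unfolding in_segment(1) by blast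
  qed
  then show ?thesis
    unfolding on comb by (simp only: plus_complex.sel Re_complex_of_real_mult Im_complex_of_real_mult)
qed

lemma polyfun_Re_Im_mult:
  assumes "polyfun (\<lambda>t. Re (f t))" "polyfun (\<lambda>t. Im (f t))" "polyfun (\<lambda>t. Re (g t))" "polyfun (\<lambda>t. Im (g t))"
  shows "polyfun (\<lambda>t. Re (f t * cnj (g t)))" "polyfun (\<lambda>t. Im (f t * cnj (g t)))"
proof -
  have "polyfun (\<lambda>t. Re (f t) * Re (g t) + Im (f t) * Im (g t))"
    "polyfun (\<lambda>t. Im (f t) * Re (g t) - Re (f t) * Im (g t))"
    by (intro polyfun_intros assms)+
  then show "polyfun (\<lambda>t. Re (f t * cnj (g t)))" "polyfun (\<lambda>t. Im (f t * cnj (g t)))"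
    by (simp_all add: algebra_simps)
qed

lemma decided_segments_meet:
  fixes a b c d :: "real \<Rightarrow> complex"
  assumes "polyfun (\<lambda>t. Re (a t))" "polyfun (\<lambda>t. Im (a t))" "polyfun (\<lambda>t. Re (b t))" "polyfun (\<lambda>t. Im (b t))"
    "polyfun (\<lambda>t. Re (c t))" "polyfun (\<lambda>t. Im (c t))" "polyfun (\<lambda>t. Re (d t))" "polyfun (\<lambda>t. Im (d t))"
  shows "decided (\<lambda>t. open_segment (a t) (b t) \<inter> closed_segment (c t) (d t) \<noteq> {}) (at_right s)"
proof -
  define \<alpha> \<beta> \<gamma> \<delta> L where
    defs: "\<alpha> t = Im ((c t - a t) * cnj (b t - a t))" "\<beta> t = Im ((d t - a t) * cnj (b t - a t))"
    "\<gamma> t = Re ((c t - a t) * cnj (b t - a t))" "\<delta> t = Re ((d t - a t) * cnj (b t - a t))"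
    \<comment> \<open>The squared length, written as a real part so that it is visibly
      polynomial.\<close>
    "L t = Re ((b t - a t) * cnj (b t - a t))" for t
  have p: "polyfun \<alpha>" "polyfun \<beta>" "polyfun \<gamma>" "polyfun \<delta>" "polyfun L"
    unfolding defs[abs_def] by (intro polyfun_Re_Im_mult; simp; intro polyfun_intros assms)+
  have L: "L t = (cmod (b t - a t))\<^sup>2" for t
    unfolding defs complex_norm_square[symmetric] by (rule Re_complex_of_real)
  \<comment> \<open>The conjunct \<open>0 < L t\<close> accounts for times with
    \<open>a t = b t\<close>, when the open segment is empty.\<close>
  have "open_segment (a t) (b t) \<inter> closed_segment (c t) (d t) \<noteq> {} \<longleftrightarrow> 0 < L t \<and>
     ((\<not> \<alpha> t = \<beta> t \<and> 0 \<le> \<alpha> t * (\<alpha> t - \<beta> t) \<and> \<alpha> t * (\<alpha> t - \<beta> t) \<le> (\<alpha> t - \<beta> t) * (\<alpha> t - \<beta> t) \<and>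
      0 < (\<alpha> t * \<delta> t - \<beta> t * \<gamma> t) * (\<alpha> t - \<beta> t) \<and>
      (\<alpha> t * \<delta> t - \<beta> t * \<gamma> t) * (\<alpha> t - \<beta> t) < L t * ((\<alpha> t - \<beta> t) * (\<alpha> t - \<beta> t))) \<or>
      (\<alpha> t = 0 \<and> \<beta> t = 0 \<and> (\<gamma> t < L t \<or> \<delta> t < L t) \<and> (0 < \<gamma> t \<or> 0 < \<delta> t)))" for t
  proof (cases "a t = b t")
    case True
    then show ?thesis by (simp add: L)
  next
    case False
    then have "0 < L t" by (simp add: L)
    then show ?thesis
      unfolding segments_meet_iff[OF False] L[symmetric] defs(1-4)[symmetric]
        chord_meets_interval_iff[OF \<open>0 < L t\<close>] by blast
  qed
  then show ?thesis by (simp only:) (intro decided_intros p)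
qed

lemma decided_ball:
  assumes "finite I" "\<And>i. i \<in> I \<Longrightarrow> decided (Q i) F"
  shows "decided (\<lambda>x. \<forall>i\<in>I. Q i x) F"
  using assms
proof (induction I)
  case empty
  then show ?case by (simp add: decided_def)
next
  case (insert i I)
  then have "decided (\<lambda>x. Q i x \<and> (\<forall>i\<in>I. Q i x)) F" by (intro decided_conj) auto
  then show ?case by simp
qed

text \<open>That the chord misses all edges is a Boolean combination of polynomial inequalities.
  Interiority of the midpoint is not expressed in this way; but while the chord misses the boundary,
  the midpoint cannot cross it, so interiority is locally constant and therefore constant on an
  interval to the right of \<open>s\<close>.\<close>

lemma decided_visible:
  assumes R: "\<forall>\<^sub>F t in at_right s. length (R t) = n \<and> simple_polygon (R t)"
    and poly: "\<And>i. i < n \<Longrightarrow> polyfun (\<lambda>t. Re (R t ! i))" "\<And>i. i < n \<Longrightarrow> polyfun (\<lambda>t. Im (R t ! i))"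
    and ij: "i < n" "j < n"
  shows "decided (\<lambda>t. visible (R t) (R t ! i) (R t ! j)) (at_right s)"
proof (cases "i = j")
  case True
  then show ?thesis by (simp add: visible_def decided_def)
next
  case False
  have suc: "Suc k mod n < n" if "k < n" for k using that by (intro mod_less_divisor) linarith
  let ?S = "\<lambda>t. open_segment (R t ! i) (R t ! j)"
  let ?free = "\<lambda>t. \<forall>k\<in>{..<n}. \<not> ?S t \<inter> closed_segment (R t ! k) (R t ! (Suc k mod n)) \<noteq> {}"
  have "decided ?free (at_right s)"
    by (intro decided_ball decided_not decided_segments_meet poly ij suc) auto
  then consider "\<forall>\<^sub>F t in at_right s. ?free t" | "\<forall>\<^sub>F t in at_right s. \<not> ?free t"
    unfolding decided_def by blast
  then show ?thesis
  proof cases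
    case 2
    with R have "\<forall>\<^sub>F t in at_right s. \<not> visible (R t) (R t ! i) (R t ! j)"
    proof eventually_elim
      case (elim t)
      then show ?case using visible_iff[of "R t" i j] ij by (auto simp: edge_def next_vertex_def)
    qed
    then show ?thesis by (simp add: decided_def)
  next
    case 1
    with R have "\<forall>\<^sub>F t in at_right s. length (R t) = n \<and> simple_polygon (R t) \<and> ?free t"
      by eventually_elim blast
    then obtain b where "s < b"
      and good: "\<And>t. s < t \<Longrightarrow> t < b \<Longrightarrow> length (R t) = n \<and> simple_polygon (R t) \<and> ?free t"
      unfolding eventually_at_right_field by blast
    define m where "m t = midpoint (R t ! i) (R t ! j)" for t
    have vis: "visible (R t) (R t ! i) (R t ! j) \<longleftrightarrow> m t \<in> polygon_interior (R t)"
      and mid: "m t \<notin> polygon_boundary (R t)" if t: "s < t" "t < b" for t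
    proof -
      have g: "length (R t) = n" "simple_polygon (R t)"
        "\<And>k. k < n \<Longrightarrow> ?S t \<inter> edge (R t) k = {}"
        using good[OF t] by (auto simp: edge_def next_vertex_def)
      then show "visible (R t) (R t ! i) (R t ! j) \<longleftrightarrow> m t \<in> polygon_interior (R t)"
        using visible_iff[of "R t" i j] ij False by (simp add: m_def)
      have "R t ! i \<noteq> R t ! j" using g ij False by (auto simp: simple_polygon_def nth_eq_iff_index_eq)
      then have "m t \<in> ?S t" unfolding m_def by simp
      then show "m t \<notin> polygon_boundary (R t)" using g(1,3) unfolding polygon_boundary_def by blast
    qed
    have cont: "((\<lambda>t. R t ! k) \<longlongrightarrow> R u ! k) (at u within A)" if "k < n" for k u A
      using polyfun_continuous[OF poly(1)[OF that]] polyfun_continuous[OF poly(2)[OF that]]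
      by (simp add: tendsto_complex_iff)
    have const: "(m t \<in> polygon_interior (R t)) = (m u \<in> polygon_interior (R u))"
      if tu: "t \<in> {s<..<b}" "u \<in> {s<..<b}" for t u
    proof (rule connected_local_const[of "{s<..<b}" t u "\<lambda>t. m t \<in> polygon_interior (R t)"])
      show "\<forall>a\<in>{s<..<b}. \<forall>\<^sub>F c in at a within {s<..<b}.
          (m a \<in> polygon_interior (R a)) = (m c \<in> polygon_interior (R c))"
      proof
        fix a assume a: "a \<in> {s<..<b}"
        have "\<forall>\<^sub>F c in at a within {s<..<b}. c \<in> {s<..<b}" by (simp add: eventually_at_filter)
        then have "\<forall>\<^sub>F c in at a within {s<..<b}. length (R c) = length (R a) \<and> simple_polygon (R c)"
          by eventually_elim (use good a in auto)
        then have "\<forall>\<^sub>F c in at a within {s<..<b}. m c \<in> polygon_interior (R c) \<longleftrightarrow> m a \<in> polygon_interior (R a)"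
        proof (rule eventually_polygon_interior[rotated 2])
          show "((\<lambda>c. R c ! k) \<longlongrightarrow> R a ! k) (at a within {s<..<b})" if "k < length (R a)" for k
            using cont that good[of a] a by simp
          show "(m \<longlongrightarrow> m a) (at a within {s<..<b})"
            unfolding m_def[abs_def] midpoint_def by (intro tendsto_intros cont ij)
        qed (use good[of a] mid[of a] a in auto)
        then show "\<forall>\<^sub>F c in at a within {s<..<b}.
            (m a \<in> polygon_interior (R a)) = (m c \<in> polygon_interior (R c))"
          by (rule eventually_mono) blast
      qed
    qed (use tu in auto)
    have ev: "\<forall>\<^sub>F t in at_right s. s < t \<and> t < b"
      using \<open>s < b\<close> unfolding eventually_at_right_field by blast
    have half: "s < (s + b) / 2" "(s + b) / 2 < b" using \<open>s < b\<close> by auto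
    show ?thesis
    proof (cases "m ((s + b) / 2) \<in> polygon_interior (R ((s + b) / 2))")
      case True
      have "\<forall>\<^sub>F t in at_right s. visible (R t) (R t ! i) (R t ! j)"
        using ev by eventually_elim (use vis const[of _ "(s + b) / 2"] half True in auto)
      then show ?thesis by (simp add: decided_def)
    next
      case False
      have "\<forall>\<^sub>F t in at_right s. \<not> visible (R t) (R t ! i) (R t ! j)"
        using ev by eventually_elim (use vis const[of _ "(s + b) / 2"] half False in auto)
      then show ?thesis by (simp add: decided_def)
    qed
  qed
qed

section \<open>Single-vertex moves\<close>

text \<open>Recorded by labels, so that polygons with different vertices can be compared by
  inclusion and counted.\<close>

definition vis :: "complex list \<Rightarrow> (nat \<times> nat) set" where
  "vis P = {(i, j). i < length P \<and> j < length P \<and> visible P (P ! i) (P ! j)}"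

lemma finite_vis: "finite (vis P)" and card_vis: "card (vis P) \<le> length P * length P"
proof -
  have "vis P \<subseteq> {..<length P} \<times> {..<length P}" by (auto simp: vis_def)
  then show "finite (vis P)" "card (vis P) \<le> length P * length P"
    using finite_subset card_mono[of "{..<length P} \<times> {..<length P}" "vis P"] by auto
qed

lemma eventually_vis:
  assumes P: "simple_polygon P"
    and len: "\<forall>\<^sub>F x in F. length (Q x) = length P"
    and lim: "\<And>i. i < length P \<Longrightarrow> ((\<lambda>x. Q x ! i) \<longlongrightarrow> P ! i) F"
  shows "\<forall>\<^sub>F x in F. simple_polygon (Q x) \<and> vis P \<subseteq> vis (Q x)"
proof -
  have "\<forall>\<^sub>F x in F. \<forall>p\<in>vis P. visible (Q x) (Q x ! fst p) (Q x ! snd p)"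
    using finite_vis by (intro eventually_ball_finite ballI eventually_visible[OF P _ _ _ len lim]) (auto simp: vis_def)
  moreover have "\<forall>\<^sub>F x in F. length (Q x) = length P \<and> simple_polygon (Q x)"
    by (rule eventually_simple_polygon[OF P len lim])
  ultimately show ?thesis
  proof eventually_elim
    case (elim x)
    have "p \<in> vis (Q x)" if "p \<in> vis P" for p
      using elim(1)[rule_format, OF that] that elim(2) by (simp add: vis_def case_prod_unfold)
    then show ?case using elim(2) by blast
  qed
qed

text \<open>Counterexamples at distances below \<open>inverse (Suc k)\<close> would converge to
  \<open>P\<close> vertex by vertex, against the eventual statement.\<close>

lemma vis_neighbourhood:
  assumes P: "simple_polygon P"
  shows "\<exists>e>0. \<forall>Q. length Q = length P \<and> (\<forall>i<length P. dist (Q ! i) (P ! i) < e) \<longrightarrow>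
    simple_polygon Q \<and> vis P \<subseteq> vis Q"
proof (rule ccontr)
  define near where "near e Q \<longleftrightarrow> length Q = length P \<and> (\<forall>i<length P. dist (Q ! i) (P ! i) < e)" for e Q
  assume "\<not> ?thesis"
  then have no: "\<exists>Q. near e Q \<and> \<not> (simple_polygon Q \<and> vis P \<subseteq> vis Q)" if "e > 0" for e
    using that unfolding near_def by blast
  have "\<forall>k. \<exists>Q. near (inverse (real (Suc k))) Q \<and> \<not> (simple_polygon Q \<and> vis P \<subseteq> vis Q)"
    by (intro allI no) simp
  then obtain Q where Q: "\<And>k. near (inverse (real (Suc k))) (Q k)"
    "\<And>k. \<not> (simple_polygon (Q k) \<and> vis P \<subseteq> vis (Q k))"
    by (auto dest!: choice)
  have "\<forall>\<^sub>F k in sequentially. simple_polygon (Q k) \<and> vis P \<subseteq> vis (Q k)"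
  proof (rule eventually_vis[OF P])
    fix i assume "i < length P"
    then have "dist (Q k ! i) (P ! i) \<le> inverse (real (Suc k))" for k
      using Q(1)[of k] by (simp add: near_def less_imp_le)
    then have "(\<lambda>k. dist (Q k ! i) (P ! i)) \<longlonglongrightarrow> 0"
      by (intro tendsto_sandwich[OF always_eventually always_eventually tendsto_const LIMSEQ_inverse_real_of_nat] allI)
        simp_all
    then show "(\<lambda>k. Q k ! i) \<longlonglongrightarrow> P ! i" by (simp add: tendsto_dist_iff[symmetric])
  next
    show "\<forall>\<^sub>F k in sequentially. length (Q k) = length P"
      using Q(1) unfolding near_def by (intro always_eventually) blast
  qed
  then obtain k where "simple_polygon (Q k) \<and> vis P \<subseteq> vis (Q k)"
    unfolding eventually_sequentially by blast
  then show False using Q(2)[of k] by blast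
qed

text \<open>Hiding the time interval lets moves be concatenated by reflexive transitive closure
  without reparametrisation.\<close>

definition vp_move :: "complex list \<Rightarrow> complex list \<Rightarrow> bool" where
  "vp_move P Q \<longleftrightarrow>
     (\<exists>a d T. single_vertex_move P a d T \<and> visibility_preserving P a d T \<and> T d = Q)"

section \<open>Straight moves and their truncation\<close>

definition straight_move :: "complex list \<Rightarrow> nat \<Rightarrow> complex \<Rightarrow> real \<Rightarrow> complex list" where
  "straight_move P m z t = P[m := (1 - t) *\<^sub>R P ! m + t *\<^sub>R z]"

lemma straight_move_simps [simp]:
  "length (straight_move P m z t) = length P"
  "straight_move P m z 0 = P" "straight_move P m z 1 = P[m := z]"
  by (simp_all add: straight_move_def)

lemma straight_move_nth:
  "i < length P \<Longrightarrow> straight_move P m z t ! i = (if i = m then (1 - t) *\<^sub>R P ! m + t *\<^sub>R z else P ! i)"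
  by (simp add: straight_move_def nth_list_update)

lemma straight_move_continuous:
  "i < length P \<Longrightarrow> continuous_on A (\<lambda>t. straight_move P m z t ! i)"
  by (cases "i = m") (auto simp: straight_move_nth intro!: continuous_intros)

lemma vp_moveD:
  assumes "vp_move P Q"
  shows "simple_polygon Q" "length Q = length P"
proof -
  obtain a d T where T: "single_vertex_move P a d T" "T d = Q"
    using assms unfolding vp_move_def by blast
  then have "transformation P a d T" by (simp only: single_vertex_move_def)
  then have "a \<le> d" "\<forall>t\<in>{a..d}. length (T t) = length P \<and> simple_polygon (T t)"
    unfolding transformation_def by blast+
  then show "simple_polygon Q" "length Q = length P" unfolding T(2)[symmetric] by auto
qed

text \<open>The end time \<open>e\<close> is free so that a move can be cut short. With
  \<open>P ! m \<noteq> z\<close> and \<open>0 < e\<close> the orbit of vertex \<open>m\<close> is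
  not constant, as a single-vertex move demands.\<close>

lemma vp_move_straight_move:
  assumes "m < length P" "P ! m \<noteq> z" "0 < e"
    and simple: "\<And>t. 0 \<le> t \<Longrightarrow> t \<le> e \<Longrightarrow> simple_polygon (straight_move P m z t)"
    and mono: "\<And>s t. 0 \<le> s \<Longrightarrow> s \<le> t \<Longrightarrow> t \<le> e \<Longrightarrow> vis (straight_move P m z s) \<subseteq> vis (straight_move P m z t)"
  shows "vp_move P (straight_move P m z e)"
  unfolding vp_move_def
proof (intro exI conjI)
  let ?R = "straight_move P m z"
  show "single_vertex_move P 0 e ?R"
    unfolding single_vertex_move_def
  proof (intro conjI ex1I)
    show "transformation P 0 e ?R"
      using assms by (auto simp: transformation_def straight_move_continuous)
    show "m < length P" by fact
    have "?R 0 ! m \<noteq> ?R e ! m" using assms(1-3) by (simp add: straight_move_nth algebra_simps)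
    moreover have "0 \<in> {0..e}" "e \<in> {0..e}" using assms(3) by auto
    ultimately show "\<not> (\<lambda>t. ?R t ! m) constant_on {0..e}" unfolding constant_on_def by metis
    fix i assume i: "i < length P \<and> \<not> (\<lambda>t. ?R t ! i) constant_on {0..e}"
    show "i = m"
    proof (rule ccontr)
      assume "i \<noteq> m"
      then have "\<forall>t\<in>{0..e}. ?R t ! i = P ! i" using i by (simp add: straight_move_nth)
      then show False using i unfolding constant_on_def by blast
    qed
  qed
  show "visibility_preserving P 0 e ?R"
    using mono unfolding visibility_preserving_def vis_def by fastforce
qed simp

text \<open>There are finitely many pairs and each is decided to the right of \<open>s\<close>, so
  on a common interval the visible pairs are precisely the eventually visible ones.\<close>

lemma straight_move_vis_at_right:
  assumes "0 \<le> s" "s < 1" "\<And>t. 0 \<le> t \<Longrightarrow> t \<le> 1 \<Longrightarrow> simple_polygon (straight_move P m z t)"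
  obtains b W where "s < b" "b \<le> 1" "\<And>t. s < t \<Longrightarrow> t < b \<Longrightarrow> vis (straight_move P m z t) = W"
proof -
  let ?R = "straight_move P m z"
  let ?n = "length P"
  let ?V = "\<lambda>i j t. visible (?R t) (?R t ! i) (?R t ! j)"
  have in01: "\<forall>\<^sub>F t in at_right s. s < t \<and> t < 1"
    using assms(2) unfolding eventually_at_right_field by blast
  have dec: "decided (?V i j) (at_right s)" if "i < ?n" "j < ?n" for i j
  proof (rule decided_visible[where n = ?n])
    show "\<forall>\<^sub>F t in at_right s. length (?R t) = ?n \<and> simple_polygon (?R t)"
      using in01 by eventually_elim (use assms in auto)
    show "polyfun (\<lambda>t. Re (?R t ! i))" "polyfun (\<lambda>t. Im (?R t ! i))" if "i < ?n" for i
      using that by (cases "i = m"; simp add: straight_move_nth polyfun_const; intro polyfun_intros)+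
  qed fact+
  define W where "W = {(i, j). i < ?n \<and> j < ?n \<and> (\<forall>\<^sub>F t in at_right s. ?V i j t)}"
  have "\<forall>\<^sub>F t in at_right s. \<forall>p\<in>{..<?n} \<times> {..<?n}. p \<in> vis (?R t) \<longleftrightarrow> p \<in> W"
  proof (intro eventually_ball_finite ballI)
    fix p assume "p \<in> {..<?n} \<times> {..<?n}"
    then obtain i j where p: "p = (i, j)" "i < ?n" "j < ?n" by auto
    show "\<forall>\<^sub>F t in at_right s. p \<in> vis (?R t) \<longleftrightarrow> p \<in> W"
    proof (cases "\<forall>\<^sub>F t in at_right s. ?V i j t")
      case True
      then show ?thesis by (rule eventually_mono) (use True p in \<open>simp add: vis_def W_def\<close>)
    next
      case False
      then have "\<forall>\<^sub>F t in at_right s. \<not> ?V i j t" using dec[OF p(2,3)] by (simp add: decided_def)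
      then show ?thesis by (rule eventually_mono) (use False p in \<open>simp add: vis_def W_def\<close>)
    qed
  qed simp
  moreover have "vis (?R t) \<subseteq> {..<?n} \<times> {..<?n}" "W \<subseteq> {..<?n} \<times> {..<?n}" for t
    by (auto simp: vis_def W_def)
  ultimately have "\<forall>\<^sub>F t in at_right s. vis (?R t) = W"
    by (elim eventually_mono) blast
  with in01 have "\<forall>\<^sub>F t in at_right s. t < 1 \<and> vis (?R t) = W" by eventually_elim blast
  then obtain b where "s < b" "\<And>t. s < t \<Longrightarrow> t < b \<Longrightarrow> t < 1 \<and> vis (?R t) = W"
    unfolding eventually_at_right_field by blast
  then show ?thesis using assms(2) by (intro that[of "min b 1" W]) auto
qed

text \<open>With \<open>s\<close> the infimum of the times of gain, the visibility set equals
  \<open>vis P\<close> up to and including \<open>s\<close> and is a constant \<open>W\<close>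
  shortly afterwards. Hence it is monotone up to any later time \<open>e\<close> in that short
  interval. The closure in the first alternative allows for the empty sequence when
  \<open>P ! m = z\<close>.\<close>

lemma straight_move_truncate:
  assumes m: "m < length P"
    and simple: "\<And>t. 0 \<le> t \<Longrightarrow> t \<le> 1 \<Longrightarrow> simple_polygon (straight_move P m z t)"
    and vis: "\<And>t. 0 \<le> t \<Longrightarrow> t \<le> 1 \<Longrightarrow> vis P \<subseteq> vis (straight_move P m z t)"
  shows "(vp_move\<^sup>*\<^sup>* P (P[m := z]) \<and> vis (P[m := z]) = vis P) \<or> (\<exists>Q. vp_move P Q \<and> vis P \<subset> vis Q)"
proof (cases "P ! m = z")
  case True
  then show ?thesis by (metis list_update_id rtranclp.rtrancl_refl)
next
  case neq: False
  let ?R = "straight_move P m z"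
  define S where "S = {t \<in> {0..1}. vis (?R t) \<noteq> vis P}"
  show ?thesis
  proof (cases "S = {}")
    case True
    then have const: "vis (?R t) = vis P" if "0 \<le> t" "t \<le> 1" for t using that by (auto simp: S_def)
    have "vp_move P (?R 1)"
      by (rule vp_move_straight_move[OF m neq]) (use simple const in auto)
    then show ?thesis using const[of 1] by auto
  next
    case False
    define s where "s = Inf S"
    have bdd: "bdd_below S" unfolding S_def by (rule bdd_belowI[of _ 0]) auto
    have s: "0 \<le> s" unfolding s_def using False by (intro cInf_greatest) (auto simp: S_def)
    have lower: "s \<le> t" if "t \<in> S" for t unfolding s_def using that bdd by (rule cInf_lower)
    have "s \<notin> S"
    proof
      assume sS: "s \<in> S"
      then have s1: "s \<le> 1" by (simp add: S_def)
      have "s \<noteq> 0" using sS by (auto simp: S_def)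
      have "\<forall>\<^sub>F t in at_left s. vis (?R s) \<subseteq> vis (?R t)"
      proof -
        have "\<forall>\<^sub>F t in at_left s. simple_polygon (?R t) \<and> vis (?R s) \<subseteq> vis (?R t)"
        proof (rule eventually_vis)
          fix i assume "i < length (?R s)"
          then have "continuous_on UNIV (\<lambda>t. ?R t ! i)" by (intro straight_move_continuous) simp
          then show "((\<lambda>t. ?R t ! i) \<longlongrightarrow> ?R s ! i) (at_left s)"
            unfolding continuous_on_def by (meson UNIV_I subset_UNIV tendsto_within_subset)
        qed (use simple s s1 in auto)
        then show ?thesis by (rule eventually_mono) blast
      qed
      then obtain b where "b < s" and b: "\<And>t. b < t \<Longrightarrow> t < s \<Longrightarrow> vis (?R s) \<subseteq> vis (?R t)"
        unfolding eventually_at_left_field by blast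
      \<comment> \<open>An earlier time at which all pairs visible at \<open>s\<close> are visible
        already; \<open>max b 0\<close> keeps it in the unit interval.\<close>
      define t where "t = (max b 0 + s) / 2"
      have t: "b < t" "t < s" "0 \<le> t" using \<open>b < s\<close> \<open>s \<noteq> 0\<close> s by (auto simp: t_def)
      have "vis (?R s) \<noteq> vis P" "vis P \<subseteq> vis (?R s)" using sS vis[of s] by (auto simp: S_def)
      then have "t \<in> S" using b[OF t(1,2)] t s1 by (auto simp: S_def)
      then show False using lower t by fastforce
    qed
    obtain t0 where t0: "t0 \<in> S" using False by blast
    then have "s < 1" using lower[OF t0] \<open>s \<notin> S\<close> by (cases "s = t0") (auto simp: S_def)
    obtain b W where b: "s < b" "b \<le> 1" "\<And>t. s < t \<Longrightarrow> t < b \<Longrightarrow> vis (?R t) = W"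
      using straight_move_vis_at_right[OF s \<open>s < 1\<close> simple] by blast
    \<comment> \<open>Times of gain accumulate at \<open>s\<close> from the right, so one of them
      falls into the interval where the visibility set is \<open>W\<close>; thus \<open>W\<close> is
      strictly larger than \<open>vis P\<close>.\<close>
    obtain e where e: "e \<in> S" "e < b"
      using b(1) cInf_lessD[OF False] unfolding s_def by blast
    have se: "s < e" using lower[OF e(1)] \<open>s \<notin> S\<close> e(1) by (cases "s = e") auto
    have e01: "0 < e" "e \<le> 1" using se s e b(2) by auto
    have W: "W = vis (?R e)" using b(3)[OF se e(2)] by simp
    have before: "vis (?R t) = vis P" if "0 \<le> t" "t \<le> s" for t
    proof -
      have "t \<notin> S" using lower[of t] that \<open>s \<notin> S\<close> by (cases "t = s") auto
      then show ?thesis using that \<open>s < 1\<close> by (auto simp: S_def)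
    qed
    have sub: "vis P \<subset> vis (?R e)" using e(1) vis[of e] e01 by (auto simp: S_def)
    have "vp_move P (?R e)"
    proof (rule vp_move_straight_move[OF m neq e01(1)])
      fix u v assume uv: "0 \<le> u" "u \<le> v" "v \<le> e"
      show "vis (?R u) \<subseteq> vis (?R v)"
      proof (cases "u \<le> s")
        case True
        then show ?thesis using before[of u] vis[of v] uv e01 by simp
      next
        case False
        then show ?thesis using b(3)[of u] b(3)[of v] uv e(2) by simp
      qed
    qed (use simple e01 in auto)
    then show ?thesis using sub by blast
  qed
qed

text \<open>The set \<open>V\<close> is fixed along a whole chain: other visibilities may come and
  go, so such a step need not be visibility-preserving.\<close>

definition admissible :: "(nat \<times> nat) set \<Rightarrow> complex list \<Rightarrow> complex list \<Rightarrow> bool" where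
  "admissible V P Q \<longleftrightarrow> (\<exists>m z. m < length P \<and> Q = P[m := z] \<and>
     (\<forall>t\<in>{0..1}. simple_polygon (straight_move P m z t) \<and> V \<subseteq> vis (straight_move P m z t)))"

text \<open>As long as the visibility set is still \<open>vis P\<close>, the next step keeps all
  visibilities of the current polygon and can be truncated. After the first gain the rest of the
  chain is discarded.\<close>

lemma admissible_chain:
  assumes "(admissible (vis P))\<^sup>*\<^sup>* P Q"
  shows "(vp_move\<^sup>*\<^sup>* P Q \<and> vis Q = vis P) \<or> (\<exists>Q'. vp_move\<^sup>*\<^sup>* P Q' \<and> vis P \<subset> vis Q')"
  using assms
proof induction
  case base
  then show ?case by blast
next
  case (step Q Q')
  show ?case
  proof (cases "vp_move\<^sup>*\<^sup>* P Q \<and> vis Q = vis P")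
    case True
    then have PQ: "vp_move\<^sup>*\<^sup>* P Q" and eq: "vis Q = vis P" by auto
    obtain m z where mz: "m < length Q" "Q' = Q[m := z]"
      "\<And>t. 0 \<le> t \<Longrightarrow> t \<le> 1 \<Longrightarrow> simple_polygon (straight_move Q m z t)"
      "\<And>t. 0 \<le> t \<Longrightarrow> t \<le> 1 \<Longrightarrow> vis Q \<subseteq> vis (straight_move Q m z t)"
      using step(2) unfolding admissible_def eq by auto
    have "(vp_move\<^sup>*\<^sup>* Q Q' \<and> vis Q' = vis Q) \<or> (\<exists>Q''. vp_move Q Q'' \<and> vis Q \<subset> vis Q'')"
      unfolding mz(2) by (rule straight_move_truncate) (use mz in auto)
    then show ?thesis
    proof
      assume "vp_move\<^sup>*\<^sup>* Q Q' \<and> vis Q' = vis Q"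
      then show ?thesis using PQ eq by (metis rtranclp_trans)
    next
      assume "\<exists>Q''. vp_move Q Q'' \<and> vis Q \<subset> vis Q''"
      then show ?thesis using PQ eq by (metis rtranclp.rtrancl_into_rtrancl)
    qed
  next
    case False
    then show ?thesis using step.IH by blast
  qed
qed

text \<open>Vertices of \<open>A\<close> are replaced by those of \<open>B\<close> one by one. Since
  balls are convex, every vertex stays in its ball of radius \<open>e\<close> throughout, even
  though \<open>A\<close> and \<open>B\<close> are only known to be near a third polygon
  \<open>P\<close>.\<close>

lemma vertexwise_admissible:
  assumes len: "length A = length P" "length B = length P"
    and near: "\<And>Q. length Q = length P \<Longrightarrow> (\<And>i. i < length P \<Longrightarrow> dist (Q ! i) (P ! i) < e) \<Longrightarrow>
      simple_polygon Q \<and> V \<subseteq> vis Q"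
    and A: "\<And>i. i < length P \<Longrightarrow> dist (A ! i) (P ! i) < e"
    and B: "\<And>i. i < length P \<Longrightarrow> dist (B ! i) (P ! i) < e"
  shows "(admissible V)\<^sup>*\<^sup>* A B"
proof -
  let ?I = "\<lambda>k. take k B @ drop k A"
  have I: "?I k ! i = (if i < k then B ! i else A ! i)" if "k \<le> length P" "i < length P" for i k
    using that len by (simp add: nth_append min_def)
  have lenI: "length (?I k) = length P" if "k \<le> length P" for k using that len by simp
  have "(admissible V)\<^sup>*\<^sup>* A (?I k)" if "k \<le> length P" for k
    using that
  proof (induction k)
    case (Suc k)
    then have k: "k < length P" by simp
    have upd: "?I (Suc k) = (?I k)[k := B ! k]"
      using k len by (intro nth_equalityI) (auto simp: nth_append nth_list_update min_def)
    have "admissible V (?I k) (?I (Suc k))"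
      unfolding admissible_def
    proof (intro exI conjI ballI)
      show "k < length (?I k)" "?I (Suc k) = (?I k)[k := B ! k]" using k lenI[of k] upd by simp_all
      fix t :: real assume t: "t \<in> {0..1}"
      have "simple_polygon (straight_move (?I k) k (B ! k) t) \<and> V \<subseteq> vis (straight_move (?I k) k (B ! k) t)"
      proof (rule near)
        fix i assume i: "i < length P"
        have "?I k ! i \<in> ball (P ! i) e" "B ! i \<in> ball (P ! i) e"
          using I[of k i] A[OF i] B[OF i] i k by (auto simp: dist_commute)
        then have "(1 - t) *\<^sub>R (?I k ! i) + t *\<^sub>R B ! i \<in> ball (P ! i) e"
          using t convex_ball[of "P ! i" e] unfolding convex_alt by auto
        then show "dist (straight_move (?I k) k (B ! k) t ! i) (P ! i) < e"
          using i k lenI[of k] \<open>?I k ! i \<in> ball (P ! i) e\<close> by (auto simp: straight_move_nth dist_commute)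
      qed (use lenI[of k] k in simp)
      then show "simple_polygon (straight_move (?I k) k (B ! k) t)" "V \<subseteq> vis (straight_move (?I k) k (B ! k) t)"
        by blast+
    qed
    then show ?case using Suc by (meson Suc_leD rtranclp.rtrancl_into_rtrancl)
  qed simp
  from this[of "length P"] show ?thesis using len by simp
qed

text \<open>Reachability from \<open>T s\<close> to \<open>T t\<close> is transitive and holds when
  \<open>s \<le> x \<le> t\<close> are close enough to \<open>x\<close>, so bisection extends it to
  the whole interval. The radius at \<open>x\<close> serves for \<open>vis P\<close> because the
  transformation gives \<open>vis P \<subseteq> vis (T x)\<close>.\<close>

lemma transformation_admissible:
  assumes T: "transformation P a d T" and vp: "visibility_preserving P a d T"
  shows "(admissible (vis P))\<^sup>*\<^sup>* P (T d)"
proof -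
  have ad: "a \<le> d" and P: "T a = P"
    and Tt: "\<forall>t\<in>{a..d}. length (T t) = length P \<and> simple_polygon (T t)"
    and cont: "\<And>i. i < length P \<Longrightarrow> continuous_on {a..d} (\<lambda>t. T t ! i)"
    using T unfolding transformation_def by blast+
  have "a \<le> a \<and> d \<le> d \<longrightarrow> (admissible (vis P))\<^sup>*\<^sup>* (T a) (T d)" using ad
  \<comment> \<open>The guard \<open>a \<le> s \<and> t \<le> d\<close> is needed since the local
    condition also ranges over times outside the interval.\<close>
  proof (rule Bolzano[where P = "\<lambda>s t. a \<le> s \<and> t \<le> d \<longrightarrow> (admissible (vis P))\<^sup>*\<^sup>* (T s) (T t)"])
    fix s t u assume "a \<le> s \<and> t \<le> d \<longrightarrow> (admissible (vis P))\<^sup>*\<^sup>* (T s) (T t)"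
      "a \<le> t \<and> u \<le> d \<longrightarrow> (admissible (vis P))\<^sup>*\<^sup>* (T t) (T u)" "s \<le> t" "t \<le> u"
    then show "a \<le> s \<and> u \<le> d \<longrightarrow> (admissible (vis P))\<^sup>*\<^sup>* (T s) (T u)"
      by (meson order_trans rtranclp_trans)
  next
    fix x assume x: "a \<le> x" "x \<le> d"
    have lx: "length (T x) = length P" "simple_polygon (T x)" using bspec[OF Tt, of x] x by auto
    have "visible (T x) (T x ! i) (T x ! j)" if "i < length P" "j < length P" "visible P (P ! i) (P ! j)" for i j
      using vp[unfolded visibility_preserving_def, rule_format, of i j a x] that x unfolding P by simp
    then have sub: "vis P \<subseteq> vis (T x)" by (auto simp: vis_def lx(1))
    obtain e where e: "0 < e" "\<And>Q. length Q = length P \<and> (\<forall>i<length P. dist (Q ! i) (T x ! i) < e) \<Longrightarrow>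
        simple_polygon Q \<and> vis (T x) \<subseteq> vis Q"
      using vis_neighbourhood[OF lx(2)] unfolding lx(1) by blast
    have "\<forall>\<^sub>F t in at x within {a..d}. \<forall>i\<in>{..<length P}. dist (T t ! i) (T x ! i) < e"
      using cont x e(1) by (intro eventually_ball_finite ballI tendstoD) (auto simp: continuous_on_def)
    then obtain r where r: "0 < r"
      "\<And>t i. t \<in> {a..d} \<Longrightarrow> t \<noteq> x \<Longrightarrow> dist t x < r \<Longrightarrow> i < length P \<Longrightarrow> dist (T t ! i) (T x ! i) < e"
      unfolding eventually_at by auto
    have close: "dist (T t ! i) (T x ! i) < e" if "t \<in> {a..d}" "dist t x < r" "i < length P" for t i
      using r(2)[OF that(1) _ that(2,3)] e(1) by (cases "t = x") auto
    show "\<exists>r>0. \<forall>s t. s \<le> x \<and> x \<le> t \<and> t - s < r \<longrightarrow>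
        a \<le> s \<and> t \<le> d \<longrightarrow> (admissible (vis P))\<^sup>*\<^sup>* (T s) (T t)"
    proof (intro exI conjI allI impI)
      fix s t assume st: "s \<le> x \<and> x \<le> t \<and> t - s < r" "a \<le> s \<and> t \<le> d"
      show "(admissible (vis P))\<^sup>*\<^sup>* (T s) (T t)"
      proof (rule vertexwise_admissible[of _ "T x" _ e])
        show "length (T s) = length (T x)" "length (T t) = length (T x)"
          using bspec[OF Tt, of s] bspec[OF Tt, of t] st x lx(1) by auto
        show "simple_polygon Q \<and> vis P \<subseteq> vis Q"
          if "length Q = length (T x)" "\<And>i. i < length (T x) \<Longrightarrow> dist (Q ! i) (T x ! i) < e" for Q
          using e(2)[of Q] that sub unfolding lx(1) by blast
      qed (use close lx st x in \<open>auto simp: dist_real_def\<close>)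
    qed (rule r(1))
  qed
  then show ?thesis using P by simp
qed

lemma vp_moves_length: "vp_move\<^sup>*\<^sup>* P Q \<Longrightarrow> simple_polygon P \<Longrightarrow> simple_polygon Q \<and> length Q = length P"
  by (induction rule: rtranclp_induct) (auto dest: vp_moveD)

text \<open>The polygon \<open>Q\<close> reached by a gain need not occur in the given
  convexification, so a new one is taken for \<open>Q\<close>; hence \<open>conv\<close> is assumed
  for all simple polygons. The induction measure counts the pairs of labels not yet visible.\<close>

lemma vp_moves_convexify:
  assumes conv: "\<And>P. simple_polygon P \<Longrightarrow> \<exists>a d T. convexification P a d T \<and> visibility_preserving P a d T"
    and "simple_polygon P"
  shows "\<exists>Q. vp_move\<^sup>*\<^sup>* P Q \<and> convex_polygon Q"
  using assms(2)
proof (induction "length P * length P - card (vis P)" arbitrary: P rule: less_induct)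
  case less
  obtain a d T where T: "convexification P a d T" "visibility_preserving P a d T"
    using conv less.prems by blast
  then have "(admissible (vis P))\<^sup>*\<^sup>* P (T d)"
    by (intro transformation_admissible) (auto simp: convexification_def)
  then consider "vp_move\<^sup>*\<^sup>* P (T d)" | Q where "vp_move\<^sup>*\<^sup>* P Q" "vis P \<subset> vis Q"
    using admissible_chain by blast
  then show ?case
  proof cases
    case 1
    then show ?thesis using T by (auto simp: convexification_def)
  next
    case 2
    have Q: "simple_polygon Q" "length Q = length P" using vp_moves_length[OF 2(1)] less.prems by auto
    have "card (vis P) < card (vis Q)" using 2 finite_vis by (intro psubset_card_mono) auto
    then have "length Q * length Q - card (vis Q) < length P * length P - card (vis P)"
      using card_vis[of Q] Q by simp
    from less.hyps[OF this Q(1)] show ?thesis using 2(1) by (meson rtranclp_trans)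
  qed
qed

theorem theorem1:
  assumes "\<forall>P. simple_polygon P \<longrightarrow>
             (\<exists>a d T. convexification P a d T \<and> visibility_preserving P a d T)"
  shows "\<forall>P. simple_polygon P \<longrightarrow>
           (\<exists>(m::nat) (Q :: nat \<Rightarrow> complex list) (a :: nat \<Rightarrow> real) (d :: nat \<Rightarrow> real)
              (T :: nat \<Rightarrow> real \<Rightarrow> complex list).
              Q 0 = P \<and>
              (\<forall>k<m. single_vertex_move (Q k) (a k) (d k) (T k) \<and>
                     visibility_preserving (Q k) (a k) (d k) (T k) \<and>
                     T k (d k) = Q (Suc k)) \<and>
              convex_polygon (Q m))"
proof (intro allI impI)
  fix P assume "simple_polygon P"
  then obtain C where "vp_move\<^sup>*\<^sup>* P C" "convex_polygon C"
    using vp_moves_convexify[of P] assms by blast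
  then obtain m Q where Q: "Q 0 = P" "Q m = C" "\<And>k. k < m \<Longrightarrow> vp_move (Q k) (Q (Suc k))"
    using rtranclp_imp_relpowp relpowp_fun_conv[of _ vp_move P C] by metis
  \<comment> \<open>The bound \<open>k < m\<close> is moved under the existential quantifiers so
    that choice yields functions defined at every \<open>k\<close>.\<close>
  then have "\<forall>k. \<exists>a d T. k < m \<longrightarrow> single_vertex_move (Q k) a d T \<and>
      visibility_preserving (Q k) a d T \<and> T d = Q (Suc k)"
    unfolding vp_move_def by blast
  then obtain a d T where "\<And>k. k < m \<Longrightarrow> single_vertex_move (Q k) (a k) (d k) (T k) \<and>
      visibility_preserving (Q k) (a k) (d k) (T k) \<and> T k (d k) = Q (Suc k)" by metis
  then show "\<exists>(m::nat) (Q :: nat \<Rightarrow> complex list) (a :: nat \<Rightarrow> real) (d :: nat \<Rightarrow> real)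
              (T :: nat \<Rightarrow> real \<Rightarrow> complex list).
              Q 0 = P \<and>
              (\<forall>k<m. single_vertex_move (Q k) (a k) (d k) (T k) \<and>
                     visibility_preserving (Q k) (a k) (d k) (T k) \<and>
                     T k (d k) = Q (Suc k)) \<and>
              convex_polygon (Q m)"
    using Q(1,2) \<open>convex_polygon C\<close> by blast
qed

end
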